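(* Let $P, N, J \geq 1$ be integers, let $I_1, \ldots, I_P$ be positive integers that are powers of two, and let $\tilde{I} = I_1 I_2 \cdots I_P$. Let $\varepsilon \in (0,1)$ and $\delta \in (0,1)$. Let $$\mathcal{Y} = \{\mathbf{x} \in \mathbb{R}^{\tilde{I}} : \mathbf{x} = \mathbf{x}^{(1)} \otimes \mathbf{x}^{(2)} \otimes \cdots \otimes \mathbf{x}^{(P)}, \text{ with } \mathbf{x}^{(p)} \in \mathbb{R}^{I_p} \text{ for each } p \in \{1,\ldots,P\}\}$$ be the set of Kronecker vectors, and let $\mathcal{X} \subseteq \mathcal{Y}$ be a (fixed) set of $N$ distinct vectors. For each $p \in \{1,\ldots,P\}$, let $\mathbf{H}^{(p)} \mathbf{D}^{(p)}$ be independent randomized Hadamard transforms of size $I_p \times I_p$, and define $$\mathbf{\Phi} = \bigotimes_{p=1}^P \mathbf{H}^{(p)} \mathbf{D}^{(p)} \in \mathbb{R}^{\tilde{I} \times \tilde{I}}.$$ Let $\mathbf{S}_{\mathbf{q}} \in \mathbb{R}^{J \times \tilde{I}}$ be the uniform sampling matrix, independent of $\mathbf{D}^{(1)}, \ldots, \mathbf{D}^{(P)}$. If $$J > \frac{16}{3} \cdot 4^P \varepsilon^{-2} \ln \Big( \frac{4 N^2 (P+1)}{\delta} \Big) \prod_{p=1}^P \ln \Big(\frac{4 I_p N^2 (P+1)}{\delta} \Big),$$ then with probability at least $1-\delta$ the following holds: $$(\forall \mathbf{x}, \mathbf{y} \in \mathcal{X}) \quad (1-\varepsilon) \| \mathbf{x}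 - \mathbf{y} \|_2^2 \leq \|\mathbf{S}_{\mathbf{q}} \mathbf{\Phi} \mathbf{x} - \mathbf{S}_{\mathbf{q}} \mathbf{\Phi} \mathbf{y} \|_2^2 \leq (1+\varepsilon) \| \mathbf{x} - \mathbf{y} \|_2^2.$$
   Context: $\otimes$ denotes the Kronecker product of matrices (and of column vectors), $\|\cdot\|_2$ is the Euclidean norm, and $\ln$ is the natural logarithm. Randomized Hadamard transform: for $I$ a power of two, let $\mathbf{H} \in \mathbb{R}^{I \times I}$ be the normalized Hadamard matrix, i.e. the orthogonal matrix defined by $\mathbf{H}_1 = [1]$ and $\mathbf{H}_{2n} = \frac{1}{\sqrt{2}} \begin{bmatrix} \mathbf{H}_n & \mathbf{H}_n \\ \mathbf{H}_n & -\mathbf{H}_n \end{bmatrix}$ (all entries are $\pm 1/\sqrt{I}$). Let $\mathbf{D} \in \mathbb{R}^{I \times I}$ be a random diagonal matrix whose diagonal entries are i.i.d. Rademacher random variables (equal to $+1$ or $-1$ with probability $1/2$ each). The $I \times I$ randomized Hadamard transform is the random matrix $\mathbf{H}\mathbf{D}$. Uniform sampling matrix: let $v_1, \ldots, v_J$ be independent random indices, each uniformly distributed on $\{1, \ldots, \tilde{I}\}$ (sampling with replacement), i.e. with distribution $\mathbf{q} = (1/\tilde{I}, \ldots, 1/\tilde{I})$. Then $\mathbf{S}_{\mathbf{q}} \in \mathbb{R}^{J \times \tilde{I}}$ is the random matrix whose $j$th row is $\sqrt{\tilde{I}/J}\; \mathbf{e}_{v_j}^\top$, where $\mathbf{e}_i$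 is the $i$th column of the $\tilde{I} \times \tilde{I}$ identity matrix. *)

theory Defs
  imports "HOL-Probability.Probability" "Jordan_Normal_Form.Matrix"
begin

no_notation vec_nth (infixl \<open>$\<close> 90)

text \<open>
  Matrices and vectors are those of \<^theory>\<open>Jordan_Normal_Form.Matrix\<close>, whose dimensions are
  natural numbers carried by the object and whose entries are indexed from 0. So the sampled
  indices range over \<open>{..<n}\<close>, the rows of the sampling matrix over \<open>{..<J}\<close>; the Kronecker
  factors are numbered from 1 to \<open>P\<close>.
\<close>

text \<open>With \<open>m = dim_vec y\<close>, entry \<open>i * m + j\<close> of the product is \<open>x $ i * y $ j\<close>.\<close>

definition kron_vec :: "real Matrix.vec \<Rightarrow> real Matrix.vec \<Rightarrow> real Matrix.vec" where
  "kron_vec x y = Matrix.vec (dim_vec x * dim_vec y)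
     (\<lambda>k. x $ (k div dim_vec y) * y $ (k mod dim_vec y))"

definition kron_mat :: "real Matrix.mat \<Rightarrow> real Matrix.mat \<Rightarrow> real Matrix.mat" where
  "kron_mat A B = Matrix.mat (dim_row A * dim_row B) (dim_col A * dim_col B)
     (\<lambda>(i, j). A $$ (i div dim_row B, j div dim_col B) * B $$ (i mod dim_row B, j mod dim_col B))"

text \<open>
  \<open>kron_vecs x P\<close> is the product of \<open>x 1, \<dots>, x P\<close>, and similarly for matrices. The
  one-dimensional unit, which is neutral for the Kronecker product, serves as the empty product.
\<close>

fun kron_vecs :: "(nat \<Rightarrow> real Matrix.vec) \<Rightarrow> nat \<Rightarrow> real Matrix.vec" where
  "kron_vecs x 0 = Matrix.vec 1 (\<lambda>_. 1)"
| "kron_vecs x (Suc p) = kron_vec (kron_vecs x p) (x (Suc p))"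

fun kron_mats :: "(nat \<Rightarrow> real Matrix.mat) \<Rightarrow> nat \<Rightarrow> real Matrix.mat" where
  "kron_mats A 0 = 1\<^sub>m 1"
| "kron_mats A (Suc p) = kron_mat (kron_mats A p) (A (Suc p))"

lemma kron_vecs_1: "kron_vecs x (Suc 0) = x (Suc 0)"
  by (auto simp: kron_vec_def)

lemma kron_mats_1: "kron_mats A (Suc 0) = A (Suc 0)"
  by (rule eq_matI) (auto simp: kron_mat_def)

definition kronecker_vectors :: "(nat \<Rightarrow> nat) \<Rightarrow> nat \<Rightarrow> real Matrix.vec set" where
  "kronecker_vectors I P = {kron_vecs x P |x. \<forall>p\<in>{1..P}. x p \<in> carrier_vec (I p)}"

definition l2_norm :: "real Matrix.vec \<Rightarrow> real" where
  "l2_norm x = L2_set (\<lambda>i. x $ i) {..<dim_vec x}"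

text \<open>Meaningful only for sizes that are powers of two; see the recursion equations below.\<close>

fun hadamard_mat :: "nat \<Rightarrow> real Matrix.mat" where
  "hadamard_mat n = (if n \<le> 1 then 1\<^sub>m 1 else
     (let H = hadamard_mat (n div 2) in (1 / sqrt 2) \<cdot>\<^sub>m four_block_mat H H H (- H)))"

declare hadamard_mat.simps [simp del]

lemma hadamard_mat_1: "hadamard_mat 1 = 1\<^sub>m 1"
  by (simp add: hadamard_mat.simps)

lemma hadamard_mat_double:
  assumes "n \<ge> 1"
  shows "hadamard_mat (2 * n) = (1 / sqrt 2) \<cdot>\<^sub>m
    four_block_mat (hadamard_mat n) (hadamard_mat n) (hadamard_mat n) (- hadamard_mat n)"
  using assms by (subst hadamard_mat.simps) (simp add: Let_def)

lemma hadamard_mat_carrier: "hadamard_mat (2 ^ k) \<in> carrier_mat (2 ^ k) (2 ^ k)"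
proof (induction k)
  case 0
  then show ?case by (simp add: hadamard_mat.simps)
next
  case (Suc k)
  then show ?case by (auto simp: hadamard_mat_double)
qed

text \<open>The randomized Hadamard transform for a given diagonal \<open>d\<close> of signs.\<close>

definition hadamard_transform :: "nat \<Rightarrow> (nat \<Rightarrow> real) \<Rightarrow> real Matrix.mat" where
  "hadamard_transform n d = hadamard_mat n * mat_diag n d"

definition sampling_mat :: "nat \<Rightarrow> nat \<Rightarrow> (nat \<Rightarrow> nat) \<Rightarrow> real Matrix.mat" where
  "sampling_mat J n v =
     mat_of_rows n (map (\<lambda>j. sqrt (real n / real J) \<cdot>\<^sub>v unit_vec n (v j)) [0..<J])"

definition rademacher :: "'a measure \<Rightarrow> ('a \<Rightarrow> real) \<Rightarrow> bool" where
  "rademacher M X \<longleftrightarrow> X \<in> borel_measurable M \<and>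
     \<P>(\<omega> in M. X \<omega> = 1) = 1 / 2 \<and> \<P>(\<omega> in M. X \<omega> = - 1) = 1 / 2"

definition uniform_index :: "'a measure \<Rightarrow> nat \<Rightarrow> ('a \<Rightarrow> nat) \<Rightarrow> bool" where
  "uniform_index M n v \<longleftrightarrow> v \<in> measurable M (count_space UNIV) \<and>
     (\<forall>i<n. \<P>(\<omega> in M. v \<omega> = i) = 1 / real n)"

end

theory Submission
  imports Defs
begin

text \<open>
  Fix two vectors \<open>x\<close>, \<open>y\<close> of the set and put \<open>z = x - y\<close>. The transform \<open>\<Phi>\<close> is an isometry for every
  choice of signs, so if \<open>\<Phi> z\<close> is flat, in the sense that \<open>n (\<Phi> z)\<^sub>i\<^sup>2 \<le> \<mu> \<parallel>z\<parallel>\<^sup>2\<close> for all \<open>i\<close> with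
  \<open>n = I\<^sub>1 \<dots> I\<^sub>P\<close>, then \<open>\<parallel>S \<Phi> z\<parallel>\<^sup>2 / \<parallel>z\<parallel>\<^sup>2\<close> is an average of \<open>J\<close> independent variables in \<open>[0, \<mu>]\<close> with mean 1.
  A Chernoff bound shows that it leaves \<open>[1 - \<epsilon>, 1 + \<epsilon>]\<close> with probability at most
  \<open>2 exp (- J \<epsilon>\<^sup>2 / (4 \<mu>))\<close> (\<open>sampling_tail\<close>). What remains is flatness with \<open>\<mu> = 4\<^sup>P \<Prod>\<^sub>p L\<^sub>p\<close>,
  where \<open>L\<^sub>p\<close> is the logarithm that belongs to factor \<open>p\<close> in the bound on \<open>J\<close>.

  The difficulty is that \<open>z\<close> is a difference of Kronecker vectors and not a Kronecker vector. But \<open>z\<close>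
  lies in the Kronecker product of the planes spanned by \<open>x\<^sub>p\<close> and \<open>y\<^sub>p\<close>, and coherence, the largest
  squared norm of the projection of a row of the transform to a subspace, is multiplicative under
  Kronecker products. A direct form of this fact for combinations \<open>a x + b y\<close> is
  \<open>kron_vecs_coherence\<close>. It reduces flatness to one factor and one plane: two fixed orthonormal
  vectors (\<open>two_dim_coherence\<close>) must have small inner products with all rows of \<open>H D\<close>. Each such inner
  product is a Rademacher sum, and Hoeffding's inequality bounds its square by \<open>2 L\<^sub>p / I\<^sub>p\<close> with high
  probability (\<open>factor_row_tail\<close>). The two vectors per plane contribute \<open>4 L\<^sub>p / I\<^sub>p\<close>, hence the
  factor \<open>4\<^sup>P\<close>.

  Flatness depends on the signs and the sampling on the indices. As the signs take finitely many
  values, their independence of the indices is used pattern by pattern. The failure probabilities of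
  a pair add up in \<open>pair_failure\<close>, and a union bound over all pairs gives the theorem.
\<close>

section \<open>Quadratic forms of pairs of Kronecker vectors\<close>

text \<open>
  The squared norm of \<open>a u + b w\<close>. The two coefficients are arguments because the inductions
  over the number of Kronecker factors absorb one entry of each removed factor into them.
\<close>

definition comb_sq :: "real \<Rightarrow> real Matrix.vec \<Rightarrow> real \<Rightarrow> real Matrix.vec \<Rightarrow> real" where
  "comb_sq a u b w = (\<Sum>k<dim_vec u. (a * u $ k + b * w $ k)\<^sup>2)"

lemma comb_sq_nonneg: "0 \<le> comb_sq a u b w"
  unfolding comb_sq_def by (intro sum_nonneg) simp

lemma sum_div_mod:
  fixes f :: "nat \<Rightarrow> nat \<Rightarrow> real"
  shows "(\<Sum>k<m * n. f (k div n) (k mod n)) = (\<Sum>i<m. \<Sum>j<n. f i j)"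
  unfolding sum_mult_product by (intro sum.cong refl) auto

lemma dim_kron_vec [simp]: "dim_vec (kron_vec x y) = dim_vec x * dim_vec y"
  by (simp add: kron_vec_def)

lemma kron_vec_index:
  "k < dim_vec x * dim_vec y \<Longrightarrow> kron_vec x y $ k = x $ (k div dim_vec y) * y $ (k mod dim_vec y)"
  by (simp add: kron_vec_def)

text \<open>
  Grouping the entries of \<open>a (u \<otimes> u') + b (w \<otimes> w')\<close> by the index into the left factor leaves, for
  each such index, a combination of the same shape built from the right factors only.
\<close>

lemma comb_sq_kron:
  assumes "dim_vec w = dim_vec u" and "dim_vec w' = dim_vec u'"
  shows "comb_sq a (kron_vec u u') b (kron_vec w w')
    = (\<Sum>i<dim_vec u. comb_sq (a * u $ i) u' (b * w $ i) w')"
proof -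
  let ?n = "dim_vec u'"
  have "comb_sq a (kron_vec u u') b (kron_vec w w') = (\<Sum>k<dim_vec u * ?n.
      (a * u $ (k div ?n) * u' $ (k mod ?n) + b * w $ (k div ?n) * w' $ (k mod ?n))\<^sup>2)"
    unfolding comb_sq_def dim_kron_vec
    by (intro sum.cong refl) (use assms in \<open>simp add: kron_vec_index mult_ac\<close>)
  also have "\<dots> = (\<Sum>i<dim_vec u. \<Sum>j<?n. (a * u $ i * u' $ j + b * w $ i * w' $ j)\<^sup>2)"
    by (rule sum_div_mod)
  finally show ?thesis
    by (simp add: comb_sq_def)
qed

lemma comb_sq_kron_right:
  assumes "dim_vec w = dim_vec u" and "dim_vec w' = dim_vec u'"
  shows "comb_sq a (kron_vec u u') b (kron_vec w w')
    = (\<Sum>j<dim_vec u'. comb_sq (a * u' $ j) u (b * w' $ j) w)"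
  unfolding comb_sq_kron[OF assms] unfolding comb_sq_def
  by (subst sum.swap) (simp add: mult_ac)

lemma dim_kron_vecs:
  assumes "\<And>p. p \<in> {1..P} \<Longrightarrow> dim_vec (x p) = I p"
  shows "dim_vec (kron_vecs x P) = (\<Prod>p=1..P. I p)"
  using assms by (induction P) auto

text \<open>
  An upper bound on the coherence of a plane is the property that an entry of the image of \<^emph>\<open>every\<close>
  combination \<open>a x + b y\<close> is controlled by the norm of that combination. In this form the bounds
  multiply over Kronecker factors: freezing the last factor turns the entries of \<open>u\<close> and \<open>w\<close> at the
  last index into new coefficients, to which the bound for the first \<open>P\<close> factors applies; the
  resulting squared norm is a sum of entries of combinations of the last factors, to which the bound
  for the last factor applies. The difference of two Kronecker vectors, which is itself not a
  Kronecker vector, is the case \<open>a = 1\<close>, \<open>b = - 1\<close>.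
\<close>

lemma kron_vecs_coherence:
  assumes "\<And>p. p \<in> {1..P} \<Longrightarrow> dim_vec (x p) = I p \<and> dim_vec (y p) = I p"
    and "\<And>p. p \<in> {1..P} \<Longrightarrow> dim_vec (u p) = I p \<and> dim_vec (w p) = I p"
    and "\<And>p. p \<in> {1..P} \<Longrightarrow> 0 \<le> m p"
    and "\<And>p i a b. p \<in> {1..P} \<Longrightarrow> i < I p \<Longrightarrow>
      (a * u p $ i + b * w p $ i)\<^sup>2 \<le> m p * comb_sq a (x p) b (y p)"
    and "k < (\<Prod>p=1..P. I p)"
  shows "(a * kron_vecs u P $ k + b * kron_vecs w P $ k)\<^sup>2
    \<le> (\<Prod>p=1..P. m p) * comb_sq a (kron_vecs x P) b (kron_vecs y P)"
  using assms
proof (induction P arbitrary: a b k)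
  case 0
  then show ?case by (simp add: comb_sq_def)
next
  case (Suc P)
  let ?I = "\<Prod>p=1..P. I p" and ?M = "\<Prod>p=1..P. m p" and ?q = "Suc P"
  let ?X = "kron_vecs x P" and ?Y = "kron_vecs y P" and ?U = "kron_vecs u P" and ?W = "kron_vecs w P"
  have dims: "dim_vec ?X = ?I" "dim_vec ?Y = ?I" "dim_vec ?U = ?I" "dim_vec ?W = ?I"
    by (intro dim_kron_vecs; use Suc.prems(1,2) in auto)+
  have dimq: "dim_vec (x ?q) = I ?q" "dim_vec (y ?q) = I ?q" "dim_vec (u ?q) = I ?q" "dim_vec (w ?q) = I ?q"
    using Suc.prems(1,2)[of ?q] by auto
  define i j where "i = k div I ?q" and "j = k mod I ?q"
  have k: "k < ?I * I ?q"
    using Suc.prems(5) by simp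
  then have j: "j < I ?q"
    unfolding j_def by (cases "I ?q = 0") auto
  have i: "i < ?I"
    using k unfolding i_def by (simp add: less_mult_imp_div_less)
  have M: "0 \<le> ?M"
    by (intro prod_nonneg) (use Suc.prems(3) in auto)
  have "(a * kron_vecs u ?q $ k + b * kron_vecs w ?q $ k)\<^sup>2
      = ((a * u ?q $ j) * ?U $ i + (b * w ?q $ j) * ?W $ i)\<^sup>2"
    using k by (simp add: kron_vec_index dims dimq i_def j_def mult_ac)
  also have "\<dots> \<le> ?M * comb_sq (a * u ?q $ j) ?X (b * w ?q $ j) ?Y"
    by (intro Suc.IH i) (use Suc.prems(1-4) in auto)
  also have "\<dots> = ?M * (\<Sum>l<?I. ((a * ?X $ l) * u ?q $ j + (b * ?Y $ l) * w ?q $ j)\<^sup>2)"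
    unfolding comb_sq_def dims by (simp add: mult_ac)
  also have "\<dots> \<le> ?M * (\<Sum>l<?I. m ?q * comb_sq (a * ?X $ l) (x ?q) (b * ?Y $ l) (y ?q))"
    by (intro mult_left_mono sum_mono Suc.prems(4) j M) auto
  also have "\<dots> = ?M * m ?q * comb_sq a (kron_vecs x ?q) b (kron_vecs y ?q)"
    by (simp add: comb_sq_kron dims dimq sum_distrib_left mult_ac)
  finally show ?case
    by simp
qed

text \<open>
  The same freezing of one factor at a time, with equality in place of the bound: first the last
  factors are replaced with the first \<open>P\<close> fixed, then the first \<open>P\<close> with the last ones fixed.
\<close>

lemma kron_vecs_isometry:
  assumes "\<And>p. p \<in> {1..P} \<Longrightarrow> dim_vec (x p) = I p \<and> dim_vec (y p) = I p"
    and "\<And>p. p \<in> {1..P} \<Longrightarrow> dim_vec (u p) = I p \<and> dim_vec (w p) = I p"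
    and "\<And>p a b. p \<in> {1..P} \<Longrightarrow> comb_sq a (u p) b (w p) = comb_sq a (x p) b (y p)"
  shows "comb_sq a (kron_vecs u P) b (kron_vecs w P) = comb_sq a (kron_vecs x P) b (kron_vecs y P)"
  using assms
proof (induction P arbitrary: a b)
  case 0
  then show ?case by simp
next
  case (Suc P)
  let ?I = "\<Prod>p=1..P. I p" and ?q = "Suc P"
  let ?X = "kron_vecs x P" and ?Y = "kron_vecs y P" and ?U = "kron_vecs u P" and ?W = "kron_vecs w P"
  have dims: "dim_vec ?X = ?I" "dim_vec ?Y = ?I" "dim_vec ?U = ?I" "dim_vec ?W = ?I"
    by (intro dim_kron_vecs; use Suc.prems(1,2) in auto)+
  have dimq: "dim_vec (x ?q) = I ?q" "dim_vec (y ?q) = I ?q" "dim_vec (u ?q) = I ?q" "dim_vec (w ?q) = I ?q"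
    using Suc.prems(1,2)[of ?q] by auto
  have "comb_sq a (kron_vecs u ?q) b (kron_vecs w ?q)
      = (\<Sum>i<?I. comb_sq (a * ?U $ i) (u ?q) (b * ?W $ i) (w ?q))"
    by (simp add: comb_sq_kron dims dimq)
  also have "\<dots> = (\<Sum>i<?I. comb_sq (a * ?U $ i) (x ?q) (b * ?W $ i) (y ?q))"
    using Suc.prems(3)[of ?q] by simp
  also have "\<dots> = comb_sq a (kron_vec ?U (x ?q)) b (kron_vec ?W (y ?q))"
    by (simp add: comb_sq_kron dims dimq)
  also have "\<dots> = (\<Sum>j<I ?q. comb_sq (a * x ?q $ j) ?U (b * y ?q $ j) ?W)"
    by (simp add: comb_sq_kron_right dims dimq)
  also have "\<dots> = (\<Sum>j<I ?q. comb_sq (a * x ?q $ j) ?X (b * y ?q $ j) ?Y)"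
    by (intro sum.cong refl Suc.IH) (use Suc.prems in auto)
  also have "\<dots> = comb_sq a (kron_vecs x ?q) b (kron_vecs y ?q)"
    by (simp add: comb_sq_kron_right dims dimq)
  finally show ?case .
qed

section \<open>Kronecker products acting on Kronecker vectors\<close>

lemma kron_mat_mult_kron_vec:
  assumes "dim_col A = dim_vec x" and "dim_col B = dim_vec y"
  shows "kron_mat A B *\<^sub>v kron_vec x y = kron_vec (A *\<^sub>v x) (B *\<^sub>v y)"
proof (rule eq_vecI)
  fix k assume "k < dim_vec (kron_vec (A *\<^sub>v x) (B *\<^sub>v y))"
  then have k: "k < dim_row A * dim_row B"
    by simp
  define i j where "i = k div dim_row B" and "j = k mod dim_row B"
  have j: "j < dim_row B"
    unfolding j_def using k by (cases "dim_row B = 0") auto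
  have i: "i < dim_row A"
    using k unfolding i_def by (simp add: less_mult_imp_div_less)
  let ?n = "dim_vec y"
  have "(kron_mat A B *\<^sub>v kron_vec x y) $ k
      = (\<Sum>l<dim_vec x * ?n. A $$ (i, l div ?n) * B $$ (j, l mod ?n) * (x $ (l div ?n) * y $ (l mod ?n)))"
    using k assms
    by (simp add: kron_mat_def scalar_prod_def kron_vec_index i_def j_def atLeast0LessThan)
  also have "\<dots> = (\<Sum>r<dim_vec x. \<Sum>s<?n. A $$ (i, r) * B $$ (j, s) * (x $ r * y $ s))"
    by (rule sum_div_mod)
  also have "\<dots> = (A *\<^sub>v x) $ i * (B *\<^sub>v y) $ j"
    using i j assms by (simp add: scalar_prod_def atLeast0LessThan sum_product mult_ac)
  also have "\<dots> = kron_vec (A *\<^sub>v x) (B *\<^sub>v y) $ k"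
    using k by (simp add: kron_vec_index i_def j_def)
  finally show "(kron_mat A B *\<^sub>v kron_vec x y) $ k = kron_vec (A *\<^sub>v x) (B *\<^sub>v y) $ k" .
qed (simp add: kron_mat_def)

lemma kron_mats_carrier:
  assumes "\<And>p. p \<in> {1..P} \<Longrightarrow> A p \<in> carrier_mat (I p) (I p)"
  shows "kron_mats A P \<in> carrier_mat (\<Prod>p=1..P. I p) (\<Prod>p=1..P. I p)"
  using assms
proof (induction P)
  case (Suc P)
  have "A (Suc P) \<in> carrier_mat (I (Suc P)) (I (Suc P))"
    "kron_mats A P \<in> carrier_mat (\<Prod>p=1..P. I p) (\<Prod>p=1..P. I p)"
    using Suc by auto
  then show ?case
    by (auto simp: kron_mat_def)
qed simp

lemma kron_mats_mult_kron_vecs: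
  assumes "\<And>p. p \<in> {1..P} \<Longrightarrow> A p \<in> carrier_mat (I p) (I p)"
    and "\<And>p. p \<in> {1..P} \<Longrightarrow> dim_vec (x p) = I p"
  shows "kron_mats A P *\<^sub>v kron_vecs x P = kron_vecs (\<lambda>p. A p *\<^sub>v x p) P"
  using assms
proof (induction P)
  case 0
  show ?case by (intro eq_vecI) (auto simp: scalar_prod_def)
next
  case (Suc P)
  have c: "kron_mats A P \<in> carrier_mat (\<Prod>p=1..P. I p) (\<Prod>p=1..P. I p)"
    by (intro kron_mats_carrier) (use Suc.prems in auto)
  have d: "dim_vec (kron_vecs x P) = (\<Prod>p=1..P. I p)"
    by (intro dim_kron_vecs) (use Suc.prems in auto)
  have "A (Suc P) \<in> carrier_mat (I (Suc P)) (I (Suc P))" "dim_vec (x (Suc P)) = I (Suc P)"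
    using Suc.prems by auto
  with c d have "kron_mats A (Suc P) *\<^sub>v kron_vecs x (Suc P)
      = kron_vec (kron_mats A P *\<^sub>v kron_vecs x P) (A (Suc P) *\<^sub>v x (Suc P))"
    by (simp add: kron_mat_mult_kron_vec)
  then show ?case
    using Suc by simp
qed

section \<open>The randomized Hadamard transform\<close>

lemma hadamard_mat_entry_sq:
  assumes "i < 2 ^ k" and "j < 2 ^ k"
  shows "(hadamard_mat (2 ^ k) $$ (i, j))\<^sup>2 = 1 / 2 ^ k"
  using assms
proof (induction k arbitrary: i j)
  case 0
  then show ?case by (simp add: hadamard_mat.simps)
next
  case (Suc k)
  have "hadamard_mat (2 ^ k) \<in> carrier_mat (2 ^ k) (2 ^ k)"
    by (rule hadamard_mat_carrier)
  then have dim [simp]: "dim_row (hadamard_mat (2 ^ k)) = 2 ^ k" "dim_col (hadamard_mat (2 ^ k)) = 2 ^ k"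
    by auto
  show ?case
    using Suc.prems by (auto simp: hadamard_mat_double Suc.IH power_divide)
qed

text \<open>
  Halving the input as \<open>(z\<^sub>1, z\<^sub>2)\<close>, the output is \<open>(H z\<^sub>1 + H z\<^sub>2, H z\<^sub>1 - H z\<^sub>2) / \<surd>2\<close>, and the
  parallelogram law reduces its squared norm to the sum of those of \<open>H z\<^sub>1\<close> and \<open>H z\<^sub>2\<close>.
\<close>

lemma hadamard_mat_isometry:
  "(\<Sum>i<2 ^ k. (\<Sum>j<2 ^ k. hadamard_mat (2 ^ k) $$ (i, j) * z j)\<^sup>2) = (\<Sum>j<2 ^ k. (z j :: real)\<^sup>2)"
proof (induction k arbitrary: z)
  case 0
  then show ?case by (simp add: hadamard_mat.simps)
next
  case (Suc k)
  let ?n = "2 ^ k :: nat" and ?H = "hadamard_mat (2 ^ k)" and ?G = "hadamard_mat (2 ^ Suc k)"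
  have "?H \<in> carrier_mat (2 ^ k) (2 ^ k)"
    by (rule hadamard_mat_carrier)
  then have dim [simp]: "dim_row ?H = 2 ^ k" "dim_col ?H = 2 ^ k"
    by auto
  have split: "(\<Sum>j<2 ^ Suc k. f j) = (\<Sum>j<?n. f j) + (\<Sum>j<?n. f (?n + j))" for f :: "nat \<Rightarrow> real"
    using sum_mult_product[of f 2 ?n] by (simp add: lessThan_nat_numeral add.commute)
  let ?p = "\<lambda>i. \<Sum>j<?n. ?H $$ (i, j) * z j" and ?q = "\<lambda>i. \<Sum>j<?n. ?H $$ (i, j) * z (?n + j)"
  have top: "(\<Sum>j<2 ^ Suc k. ?G $$ (i, j) * z j) = (?p i + ?q i) / sqrt 2" if "i < ?n" for i
    unfolding split using that by (simp add: hadamard_mat_double add_divide_distrib sum_divide_distrib)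
  have bot: "(\<Sum>j<2 ^ Suc k. ?G $$ (?n + i, j) * z j) = (?p i - ?q i) / sqrt 2" if "i < ?n" for i
    unfolding split using that
    by (simp add: hadamard_mat_double diff_divide_distrib sum_divide_distrib sum_negf)
  have "(\<Sum>i<2 ^ Suc k. (\<Sum>j<2 ^ Suc k. ?G $$ (i, j) * z j)\<^sup>2)
      = (\<Sum>i<?n. ((?p i + ?q i) / sqrt 2)\<^sup>2) + (\<Sum>i<?n. ((?p i - ?q i) / sqrt 2)\<^sup>2)"
    unfolding split[of "\<lambda>i. (\<Sum>j<2 ^ Suc k. ?G $$ (i, j) * z j)\<^sup>2"]
    by (intro arg_cong2[of _ _ _ _ "(+)"] sum.cong refl) (simp_all only: top bot lessThan_iff)
  also have "\<dots> = (\<Sum>i<?n. (?p i)\<^sup>2 + (?q i)\<^sup>2)"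
  proof -
    have "((p + q) / sqrt 2)\<^sup>2 + ((p - q) / sqrt 2)\<^sup>2 = p\<^sup>2 + q\<^sup>2" for p q :: real
      by (simp add: power_divide power2_sum power2_diff add_divide_distrib[symmetric])
    then show ?thesis
      by (intro trans[OF sum.distrib[symmetric]]) (simp only:)
  qed
  also have "\<dots> = (\<Sum>j<?n. (z j)\<^sup>2) + (\<Sum>j<?n. (z (?n + j))\<^sup>2)"
    by (simp only: sum.distrib Suc.IH)
  finally show ?case
    by (simp only: split)
qed

lemma hadamard_transform_carrier: "hadamard_transform (2 ^ k) s \<in> carrier_mat (2 ^ k) (2 ^ k)"
  unfolding hadamard_transform_def
  using hadamard_mat_carrier mat_diag_dim by (rule mult_carrier_mat)

lemma hadamard_transform_entry:
  assumes "i < 2 ^ k" and "j < 2 ^ k"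
  shows "hadamard_transform (2 ^ k) s $$ (i, j) = hadamard_mat (2 ^ k) $$ (i, j) * s j"
  unfolding hadamard_transform_def mat_diag_mult_right[OF hadamard_mat_carrier] using assms by simp

lemma hadamard_transform_mult_vec:
  assumes "i < 2 ^ k" and "dim_vec x = 2 ^ k"
  shows "(hadamard_transform (2 ^ k) s *\<^sub>v x) $ i = (\<Sum>j<2 ^ k. hadamard_mat (2 ^ k) $$ (i, j) * s j * x $ j)"
proof -
  have "dim_row (hadamard_transform (2 ^ k) s) = 2 ^ k" "dim_col (hadamard_transform (2 ^ k) s) = 2 ^ k"
    using hadamard_transform_carrier[of k s] by auto
  then show ?thesis
    using assms by (simp add: scalar_prod_def hadamard_transform_entry atLeast0LessThan)
qed

lemma hadamard_transform_isometry:
  assumes s: "\<And>j. j < 2 ^ k \<Longrightarrow> (s j)\<^sup>2 = 1" and x: "dim_vec x = 2 ^ k" and y: "dim_vec y = 2 ^ k"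
  shows "comb_sq a (hadamard_transform (2 ^ k) s *\<^sub>v x) b (hadamard_transform (2 ^ k) s *\<^sub>v y)
    = comb_sq a x b y"
proof -
  have dim: "dim_row (hadamard_transform (2 ^ k) s) = 2 ^ k"
    using hadamard_transform_carrier[of k s] by auto
  have "comb_sq a (hadamard_transform (2 ^ k) s *\<^sub>v x) b (hadamard_transform (2 ^ k) s *\<^sub>v y)
      = (\<Sum>i<2 ^ k. (\<Sum>j<2 ^ k. hadamard_mat (2 ^ k) $$ (i, j) * (s j * (a * x $ j + b * y $ j)))\<^sup>2)"
    unfolding comb_sq_def dim_mult_mat_vec dim
    by (intro sum.cong refl arg_cong[of _ _ "\<lambda>r. r\<^sup>2"])
       (simp add: hadamard_transform_mult_vec x y sum_distrib_left sum.distrib[symmetric] algebra_simps)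
  also have "\<dots> = (\<Sum>j<2 ^ k. (s j * (a * x $ j + b * y $ j))\<^sup>2)"
    by (rule hadamard_mat_isometry)
  also have "\<dots> = comb_sq a x b y"
    unfolding comb_sq_def x by (intro sum.cong refl) (simp add: power_mult_distrib s)
  finally show ?thesis .
qed

section \<open>Coherence of a plane\<close>

text \<open>
  Normalization of a vector that may vanish, in which case \<open>p = 0\<close> and \<open>e = 0\<close>. The third and fourth
  properties say that the squared norm of \<open>e\<close> acts as 1 wherever it is needed; they let the
  Gram--Schmidt process below treat dependent and independent pairs alike.
\<close>

lemma sum_sq_normalize:
  fixes x :: "nat \<Rightarrow> real"
  obtains p e where "\<And>j. j < n \<Longrightarrow> x j = p * e j" and "(\<Sum>j<n. (e j)\<^sup>2) \<le> 1"
    and "\<And>j. j < n \<Longrightarrow> e j * (\<Sum>j<n. (e j)\<^sup>2) = e j" and "p * (\<Sum>j<n. (e j)\<^sup>2) = p"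
    and "\<And>z. (\<Sum>j<n. x j * z j) = 0 \<Longrightarrow> (\<Sum>j<n. e j * z j) = 0"
proof (cases "(\<Sum>j<n. (x j)\<^sup>2) = 0")
  case True
  then have "\<And>j. j < n \<Longrightarrow> x j = 0"
    by (simp add: sum_nonneg_eq_0_iff)
  then show ?thesis
    by (intro that[of 0 "\<lambda>_. 0"]) auto
next
  case False
  define p where "p = sqrt (\<Sum>j<n. (x j)\<^sup>2)"
  have p2: "p\<^sup>2 = (\<Sum>j<n. (x j)\<^sup>2)"
    by (simp add: p_def sum_nonneg)
  with False have p: "p \<noteq> 0"
    by auto
  have 1: "(\<Sum>j<n. (x j / p)\<^sup>2) = 1"
    using p by (simp add: power_divide sum_divide_distrib[symmetric] p2[symmetric])
  show ?thesis
    by (rule that[of p "\<lambda>j. x j / p"]) (use p 1 in \<open>auto simp: sum_divide_distrib[symmetric]\<close>)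
qed

text \<open>
  Gram--Schmidt gives an orthonormal basis \<open>e\<close>, \<open>f\<close> of the span of \<open>x\<close> and \<open>y\<close> (with zero vectors if
  the span is smaller), and the bound is the Cauchy--Schwarz inequality in that basis. The basis does
  not depend on the row \<open>r\<close>, so a random row only has to be tested against two fixed unit vectors.
\<close>

lemma two_dim_coherence:
  fixes x y :: "nat \<Rightarrow> real"
  obtains e f where "(\<Sum>j<n. (e j)\<^sup>2) \<le> 1" and "(\<Sum>j<n. (f j)\<^sup>2) \<le> 1"
    and "\<And>r a b. (a * (\<Sum>j<n. r j * x j) + b * (\<Sum>j<n. r j * y j))\<^sup>2
      \<le> ((\<Sum>j<n. r j * e j)\<^sup>2 + (\<Sum>j<n. r j * f j)\<^sup>2) * (\<Sum>j<n. (a * x j + b * y j)\<^sup>2)"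
proof -
  obtain p e where xe: "\<And>j. j < n \<Longrightarrow> x j = p * e j" and e1: "(\<Sum>j<n. (e j)\<^sup>2) \<le> 1"
    and ee: "\<And>j. j < n \<Longrightarrow> e j * (\<Sum>j<n. (e j)\<^sup>2) = e j" and pe: "p * (\<Sum>j<n. (e j)\<^sup>2) = p"
    by (rule sum_sq_normalize[of n x]) blast
  \<comment> \<open>The component of \<open>y\<close> along \<open>e\<close>; the remainder \<open>y - q e\<close> is normalized to \<open>f\<close>.\<close>
  define q where "q = (\<Sum>j<n. y j * e j)"
  obtain r f where yf: "\<And>j. j < n \<Longrightarrow> y j - q * e j = r * f j" and f1: "(\<Sum>j<n. (f j)\<^sup>2) \<le> 1"
    and rf: "r * (\<Sum>j<n. (f j)\<^sup>2) = r"
    and orth: "\<And>z. (\<Sum>j<n. (y j - q * e j) * z j) = 0 \<Longrightarrow> (\<Sum>j<n. f j * z j) = 0"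
    by (rule sum_sq_normalize[of n "\<lambda>j. y j - q * e j"]) blast
  have qe: "q * (\<Sum>j<n. (e j)\<^sup>2) = q"
    unfolding q_def sum_distrib_right by (intro sum.cong refl) (simp add: ee mult.assoc)
  have "(\<Sum>j<n. (y j - q * e j) * e j) = (\<Sum>j<n. y j * e j) - q * (\<Sum>j<n. (e j)\<^sup>2)"
    by (simp add: algebra_simps sum_subtractf sum_distrib_left power2_eq_square)
  then have fe: "(\<Sum>j<n. f j * e j) = 0"
    by (intro orth) (simp add: qe q_def[symmetric])
  have norm: "(\<Sum>j<n. (c * e j + d * r * f j)\<^sup>2) = c\<^sup>2 + (d * r)\<^sup>2" if c: "c * (\<Sum>j<n. (e j)\<^sup>2) = c" for c d
  proof -
    have "(\<Sum>j<n. (c * e j + d * r * f j)\<^sup>2)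
        = c * (c * (\<Sum>j<n. (e j)\<^sup>2)) + d\<^sup>2 * r * (r * (\<Sum>j<n. (f j)\<^sup>2)) + 2 * c * d * r * (\<Sum>j<n. f j * e j)"
    proof -
      have "(c * e j + d * r * f j)\<^sup>2
          = c * (c * (e j)\<^sup>2) + d\<^sup>2 * r * (r * (f j)\<^sup>2) + 2 * c * d * r * (f j * e j)" for j
        by (simp add: power2_eq_square algebra_simps)
      then show ?thesis
        by (simp only: sum.distrib sum_distrib_left)
    qed
    then show ?thesis
      unfolding c rf fe by (simp add: power2_eq_square)
  qed
  show ?thesis
  proof (rule that[OF e1 f1])
    fix s :: "nat \<Rightarrow> real" and a b :: real
    let ?E = "\<Sum>j<n. s j * e j" and ?F = "\<Sum>j<n. s j * f j" and ?c = "a * p + b * q"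
    \<comment> \<open>Coordinates of \<open>a x + b y\<close> in the basis \<open>e\<close>, \<open>f\<close>.\<close>
    have comb: "a * x j + b * y j = ?c * e j + b * r * f j" if "j < n" for j
      using xe[OF that] yf[OF that] by (simp add: algebra_simps eq_diff_eq)
    have "a * (\<Sum>j<n. s j * x j) + b * (\<Sum>j<n. s j * y j) = (\<Sum>j<n. s j * (a * x j + b * y j))"
      by (simp add: sum_distrib_left sum.distrib[symmetric] algebra_simps)
    also have "\<dots> = (\<Sum>j<n. s j * (?c * e j + b * r * f j))"
      by (intro sum.cong refl) (simp add: comb)
    also have "\<dots> = ?E * ?c + ?F * (b * r)"
      by (simp add: sum_distrib_left sum_distrib_right sum.distrib[symmetric] algebra_simps)
    finally have "(a * (\<Sum>j<n. s j * x j) + b * (\<Sum>j<n. s j * y j))\<^sup>2 = (?E * ?c + ?F * (b * r))\<^sup>2"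
      by simp
    also have "\<dots> \<le> (?E\<^sup>2 + ?F\<^sup>2) * (?c\<^sup>2 + (b * r)\<^sup>2)"
    proof -
      have "0 \<le> (?E * (b * r) - ?F * ?c)\<^sup>2" by simp
      then show ?thesis by (simp add: power2_eq_square algebra_simps)
    qed
    also have "?c\<^sup>2 + (b * r)\<^sup>2 = (\<Sum>j<n. (?c * e j + b * r * f j)\<^sup>2)"
      by (rule norm[symmetric]) (simp only: distrib_right mult.assoc pe qe)
    also have "\<dots> = (\<Sum>j<n. (a * x j + b * y j)\<^sup>2)"
      by (intro sum.cong refl) (simp add: comb)
    finally show "(a * (\<Sum>j<n. s j * x j) + b * (\<Sum>j<n. s j * y j))\<^sup>2
      \<le> (?E\<^sup>2 + ?F\<^sup>2) * (\<Sum>j<n. (a * x j + b * y j)\<^sup>2)" .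
  qed
qed

section \<open>Rademacher sums and uniform indices\<close>

context prob_space
begin

lemma indep_vars_rv:
  "indep_vars M' X T \<Longrightarrow> k \<in> T \<Longrightarrow> X k \<in> measurable M (M' k)"
  unfolding indep_vars_def by blast

lemma indep_vars_reindex:
  assumes indep: "indep_vars M' X (h ` T)" and inj: "inj_on h T"
  shows "indep_vars (\<lambda>k. M' (h k)) (\<lambda>k. X (h k)) T"
  unfolding indep_vars_def2
proof (intro conjI ballI indep_setsI)
  fix k assume "k \<in> T"
  then show rv: "X (h k) \<in> measurable M (M' (h k))"
    using indep unfolding indep_vars_def2 by auto
  then show "{X (h k) -` A \<inter> space M |A. A \<in> sets (M' (h k))} \<subseteq> events"
    by (auto intro: measurable_sets)
next
  fix A L assume L: "L \<noteq> {}" "L \<subseteq> T" "finite L"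
    and A: "\<forall>k\<in>L. A k \<in> {X (h k) -` B \<inter> space M |B. B \<in> sets (M' (h k))}"
  have injL: "inj_on h L"
    using inj L(2) by (rule inj_on_subset)
  define A' where "A' = A \<circ> inv_into L h"
  have A': "A' (h k) = A k" if "k \<in> L" for k
    using injL that by (simp add: A'_def)
  have "indep_sets (\<lambda>i. {X i -` B \<inter> space M |B. B \<in> sets (M' i)}) (h ` T)"
    using indep by (simp add: indep_vars_def2)
  then have "prob (\<Inter>i\<in>h ` L. A' i) = (\<Prod>i\<in>h ` L. prob (A' i))"
    by (rule indep_setsD) (use L A A' in auto)
  then show "prob (\<Inter>k\<in>L. A k) = (\<Prod>k\<in>L. prob (A k))"
    by (simp add: prod.reindex[OF injL] A' cong: INF_cong_simp prod.cong)
qed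

lemma rademacher_AE:
  assumes "rademacher M X"
  shows "AE \<omega> in M. X \<omega> = 1 \<or> X \<omega> = - 1"
proof -
  have [measurable]: "X \<in> borel_measurable M"
    using assms by (simp add: rademacher_def)
  have "prob ({\<omega>\<in>space M. X \<omega> = 1} \<union> {\<omega>\<in>space M. X \<omega> = - 1})
      = prob {\<omega>\<in>space M. X \<omega> = 1} + prob {\<omega>\<in>space M. X \<omega> = - 1}"
    by (intro finite_measure_Union) auto
  also have "\<dots> = 1"
    using assms by (simp add: rademacher_def)
  finally have "AE \<omega> in M. \<omega> \<in> {\<omega>\<in>space M. X \<omega> = 1} \<union> {\<omega>\<in>space M. X \<omega> = - 1}"
    by (rule AE_prob_1)
  then show ?thesis
    by eventually_elim auto
qed

lemma rademacher_expectation: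
  assumes "rademacher M X"
  shows "expectation X = 0"
proof -
  have [measurable]: "X \<in> borel_measurable M"
    using assms by (simp add: rademacher_def)
  have "expectation X = expectation (\<lambda>\<omega>. indicator {\<omega>\<in>space M. X \<omega> = 1} \<omega>
      - indicator {\<omega>\<in>space M. X \<omega> = - 1} \<omega>)"
    by (rule integral_cong_AE) (use rademacher_AE[OF assms] in \<open>auto simp: indicator_def\<close>)
  also have "\<dots> = prob {\<omega>\<in>space M. X \<omega> = 1} - prob {\<omega>\<in>space M. X \<omega> = - 1}"
    by (subst Bochner_Integration.integral_diff)
       (auto intro!: integrable_real_indicator simp: less_top[symmetric])
  finally show ?thesis
    using assms by (simp add: rademacher_def)
qed

text \<open>
  Hoeffding's inequality for summands in \<open>[- \<bar>c k\<bar>, \<bar>c k\<bar>]\<close> of mean zero. The bound is stated through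
  an upper bound \<open>s\<close> of the sum of squares, which allows the coefficients to vanish altogether.
\<close>

lemma rademacher_sum_tail:
  fixes d :: "'k \<Rightarrow> 'a \<Rightarrow> real"
  assumes fin: "finite T" and indep: "indep_vars (\<lambda>_. borel) d T"
    and rad: "\<And>k. k \<in> T \<Longrightarrow> rademacher M (d k)"
    and c: "(\<Sum>k\<in>T. (c k)\<^sup>2) \<le> s" and s: "0 < s" and t: "0 < t"
  shows "prob {\<omega>\<in>space M. t \<le> \<bar>\<Sum>k\<in>T. c k * d k \<omega>\<bar>} \<le> 2 * exp (- (t\<^sup>2 / (2 * s)))"
proof (cases "(\<Sum>k\<in>T. (c k)\<^sup>2) = 0")
  case True
  then have "\<And>k. k \<in> T \<Longrightarrow> c k = 0"
    using fin by (simp add: sum_nonneg_eq_0_iff)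
  then have "{\<omega>\<in>space M. t \<le> \<bar>\<Sum>k\<in>T. c k * d k \<omega>\<bar>} = {}"
    using t by auto
  then show ?thesis
    by (metis measure_empty exp_ge_zero mult_nonneg_nonneg zero_le_numeral)
next
  case False
  then have pos: "0 < (\<Sum>k\<in>T. (c k)\<^sup>2)"
    by (simp add: less_le sum_nonneg)
  have ind: "indep_vars (\<lambda>_. borel) (\<lambda>k \<omega>. c k * d k \<omega>) T"
    by (rule indep_vars_compose2[OF indep]) simp
  define \<mu> where "\<mu> = (\<Sum>k\<in>T. expectation (\<lambda>\<omega>. c k * d k \<omega>))"
  interpret Hoeffding_ineq M T "\<lambda>k \<omega>. c k * d k \<omega>" "\<lambda>k. - \<bar>c k\<bar>" "\<lambda>k. \<bar>c k\<bar>" \<mu>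
  proof unfold_locales
    fix k assume "k \<in> T"
    then show "AE \<omega> in M. c k * d k \<omega> \<in> {- \<bar>c k\<bar>..\<bar>c k\<bar>}"
      using rademacher_AE[OF rad, of k] by (auto elim!: eventually_mono)
  qed (use fin ind \<mu>_def in auto)
  have \<mu>: "\<mu> = 0"
    unfolding \<mu>_def by (intro sum.neutral) (simp add: rademacher_expectation rad)
  have w: "(\<Sum>k\<in>T. (\<bar>c k\<bar> - - \<bar>c k\<bar>)\<^sup>2) = 4 * (\<Sum>k\<in>T. (c k)\<^sup>2)"
    by (simp add: sum_distrib_left power2_sum power2_eq_square mult.assoc)
  have "prob {\<omega>\<in>space M. t \<le> \<bar>\<Sum>k\<in>T. c k * d k \<omega>\<bar>}
      \<le> 2 * exp (- 2 * t\<^sup>2 / (4 * (\<Sum>k\<in>T. (c k)\<^sup>2)))"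
    using Hoeffding_ineq_abs_ge[of t] t pos unfolding \<mu> w by simp
  also have "\<dots> \<le> 2 * exp (- (t\<^sup>2 / (2 * s)))"
  proof -
    have "t\<^sup>2 / (2 * s) \<le> t\<^sup>2 / (2 * (\<Sum>k\<in>T. (c k)\<^sup>2))"
      using c pos s by (intro divide_left_mono) auto
    then show ?thesis
      by simp
  qed
  finally show ?thesis .
qed

lemma uniform_index_AE:
  assumes "uniform_index M n v" and "0 < n"
  shows "AE \<omega> in M. v \<omega> < n"
proof -
  have [measurable]: "v \<in> measurable M (count_space UNIV)"
    using assms by (simp add: uniform_index_def)
  have "prob (\<Union>i<n. {\<omega>\<in>space M. v \<omega> = i}) = (\<Sum>i<n. prob {\<omega>\<in>space M. v \<omega> = i})"
    by (intro finite_measure_finite_Union) (auto simp: disjoint_family_on_def)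
  also have "\<dots> = 1"
    using assms by (simp add: uniform_index_def)
  finally have "AE \<omega> in M. \<omega> \<in> (\<Union>i<n. {\<omega>\<in>space M. v \<omega> = i})"
    by (rule AE_prob_1)
  then show ?thesis
    by eventually_elim auto
qed

lemma uniform_index_integral:
  fixes f :: "nat \<Rightarrow> real"
  assumes v: "uniform_index M n v" and n: "0 < n"
  shows "has_bochner_integral M (\<lambda>\<omega>. f (v \<omega>)) ((\<Sum>i<n. f i) / n)"
proof -
  have [measurable]: "v \<in> measurable M (count_space UNIV)"
    using v by (simp add: uniform_index_def)
  have "has_bochner_integral M (\<lambda>\<omega>. \<Sum>i<n. f i * indicator {\<omega>\<in>space M. v \<omega> = i} \<omega>)
      (\<Sum>i<n. f i * prob {\<omega>\<in>space M. v \<omega> = i})"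
    by (intro has_bochner_integral_sum has_bochner_integral_mult_right
        has_bochner_integral_real_indicator) (auto simp: less_top[symmetric])
  also have "(\<Sum>i<n. f i * prob {\<omega>\<in>space M. v \<omega> = i}) = (\<Sum>i<n. f i) / n"
    using v by (simp add: uniform_index_def sum_divide_distrib)
  also have "has_bochner_integral M (\<lambda>\<omega>. \<Sum>i<n. f i * indicator {\<omega>\<in>space M. v \<omega> = i} \<omega>)
      ((\<Sum>i<n. f i) / n) \<longleftrightarrow> has_bochner_integral M (\<lambda>\<omega>. f (v \<omega>)) ((\<Sum>i<n. f i) / n)"
  proof (rule has_bochner_integral_cong_AE)
    show "AE \<omega> in M. (\<Sum>i<n. f i * indicator {\<omega>\<in>space M. v \<omega> = i} \<omega>) = f (v \<omega>)"
      using uniform_index_AE[OF v n] AE_space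
      by eventually_elim (simp add: indicator_def if_distrib cong: if_cong)
  qed measurable
  finally show ?thesis .
qed

end

section \<open>Concentration of the sampled entries\<close>

lemma exp_le_quadratic:
  fixes u :: real
  assumes "\<bar>u\<bar> \<le> 1"
  shows "exp u \<le> 1 + u + u\<^sup>2"
proof (cases "0 \<le> u")
  case True
  then show ?thesis
    using assms by (intro exp_bound) auto
next
  case False
  define w where "w = - u"
  have w: "0 < w"
    using False by (simp add: w_def)
  have "1 \<le> 1 + w ^ 3"
    using w by simp
  also have "\<dots> = (1 + w) * (1 - w + w\<^sup>2)"
    by (simp add: power2_eq_square power3_eq_cube algebra_simps)
  also have "\<dots> \<le> exp w * (1 - w + w\<^sup>2)"
  proof (intro mult_right_mono exp_ge_add_one_self)
    show "0 \<le> 1 - w + w\<^sup>2"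
      using assms by (simp add: w_def)
  qed
  finally show ?thesis
    by (simp add: w_def exp_minus field_simps)
qed

text \<open>
  Moment generating function of a variable in \<open>[0, m]\<close> with mean 1. Scaled by \<open>1 / m\<close> it becomes a
  variable \<open>y\<close> in \<open>[0, 1]\<close>, whose second moment is at most its mean \<open>1 / m\<close>; hence the bound is
  exponential in \<open>1 / m\<close> instead of the \<open>1\<close> that a bound by the range alone would give.
\<close>

lemma average_exp_le:
  fixes g :: "nat \<Rightarrow> real"
  assumes n: "0 < n" and m: "0 < m" and g: "\<And>i. i < n \<Longrightarrow> 0 \<le> g i \<and> g i \<le> m"
    and mean: "(\<Sum>i<n. g i) = n" and s: "\<bar>s\<bar> \<le> 1"
  shows "(\<Sum>i<n. exp (s * g i / m)) / n \<le> exp ((s + s\<^sup>2) / m)"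
proof -
  have "(\<Sum>i<n. exp (s * g i / m)) \<le> (\<Sum>i<n. 1 + (s + s\<^sup>2) / m * g i)"
  proof (rule sum_mono)
    fix i assume "i \<in> {..<n}"
    define y where "y = g i / m"
    have y: "0 \<le> y" "y \<le> 1"
      using g[of i] \<open>i \<in> {..<n}\<close> m by (auto simp: y_def)
    \<comment> \<open>The quadratic term is linear in \<open>y\<close> up to a constant, since \<open>y\<^sup>2 \<le> y\<close>.\<close>
    have "exp (s * y) \<le> 1 + s * y + (s * y)\<^sup>2"
      by (rule exp_le_quadratic) (use y s in \<open>simp add: abs_mult mult_le_one\<close>)
    also have "(s * y)\<^sup>2 \<le> s\<^sup>2 * y"
      using y by (auto simp: power_mult_distrib power2_eq_square[of y] mult_left_le intro!: mult_left_mono)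
    finally show "exp (s * g i / m) \<le> 1 + (s + s\<^sup>2) / m * g i"
      by (simp add: y_def algebra_simps add_divide_distrib)
  qed
  also have "\<dots> = n * (1 + (s + s\<^sup>2) / m)"
    by (simp only: sum.distrib sum_distrib_left[symmetric] mean) (simp add: algebra_simps)
  finally have "(\<Sum>i<n. exp (s * g i / m)) / n \<le> 1 + (s + s\<^sup>2) / m"
    using n by (simp add: field_simps)
  also have "\<dots> \<le> exp ((s + s\<^sup>2) / m)"
    by (rule exp_ge_add_one_self)
  finally show ?thesis .
qed

context prob_space
begin

text \<open>
  A fixed sign pattern \<open>\<sigma>\<close> can be handled without conditioning: the indicator of the event that the
  signs equal \<open>\<sigma>\<close> is a product of functions of the single signs, so together with the factors that
  come from the indices it is one product over the joint independent family.
\<close>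

lemma expectation_on_pattern:
  fixes d :: "'k \<Rightarrow> 'a \<Rightarrow> real" and v :: "nat \<Rightarrow> 'a \<Rightarrow> nat" and f :: "nat \<Rightarrow> real"
  assumes fin: "finite K"
    and indep: "indep_vars (\<lambda>_. borel) (case_sum d (\<lambda>j \<omega>. real (v j \<omega>))) (K <+> {..<J})"
    and v: "\<And>j. j < J \<Longrightarrow> uniform_index M n (v j)" and n: "0 < n"
  shows "has_bochner_integral M
    (\<lambda>\<omega>. indicator {\<omega>\<in>space M. \<forall>k\<in>K. d k \<omega> = \<sigma> k} \<omega> * (\<Prod>j<J. f (v j \<omega>)))
    (prob {\<omega>\<in>space M. \<forall>k\<in>K. d k \<omega> = \<sigma> k} * ((\<Sum>i<n. f i) / n) ^ J)"
proof -
  let ?A = "{\<omega>\<in>space M. \<forall>k\<in>K. d k \<omega> = \<sigma> k}"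
  have d [measurable]: "d k \<in> borel_measurable M" if "k \<in> K" for k
    using indep_vars_rv[OF indep InlI[OF that]] by simp
  have A: "?A \<in> events"
    by measurable (use fin in \<open>auto simp: countable_finite\<close>)
  have *: "has_bochner_integral M (\<lambda>\<omega>. indicator ?A \<omega> * (\<Prod>j<J. f (v j \<omega>)))
      ((\<Prod>k\<in>K. prob {\<omega>\<in>space M. d k \<omega> = \<sigma> k}) * ((\<Sum>i<n. f i) / n) ^ J)" for f :: "nat \<Rightarrow> real"
  proof -
    let ?h = "case_sum (\<lambda>k. indicator {\<sigma> k}) (\<lambda>_ r. f (nat \<lfloor>r\<rfloor>)) :: 'k + nat \<Rightarrow> real \<Rightarrow> real"
    let ?F = "case_sum d (\<lambda>j \<omega>. real (v j \<omega>))"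
    have ind: "indep_vars (\<lambda>_. borel) (\<lambda>x \<omega>. ?h x (?F x \<omega>)) (K <+> {..<J})"
    proof (rule indep_vars_compose2[OF indep])
      fix x assume "x \<in> K <+> {..<J}"
      show "?h x \<in> borel_measurable borel"
        by (cases x) auto
    qed
    have sgn: "has_bochner_integral M (\<lambda>\<omega>. ?h (Inl k) (?F (Inl k) \<omega>)) (prob {\<omega>\<in>space M. d k \<omega> = \<sigma> k})"
      if "k \<in> K" for k
    proof -
      have "has_bochner_integral M (indicator {\<omega>\<in>space M. d k \<omega> = \<sigma> k} :: 'a \<Rightarrow> real) (prob {\<omega>\<in>space M. d k \<omega> = \<sigma> k})"
        using d[OF that] by (intro has_bochner_integral_real_indicator) (auto simp: less_top[symmetric])
      then show ?thesis
        by (rule has_bochner_integral_cong[THEN iffD1, rotated -1]) (auto simp: indicator_def)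
    qed
    have idx: "has_bochner_integral M (\<lambda>\<omega>. ?h (Inr j) (?F (Inr j) \<omega>)) ((\<Sum>i<n. f i) / n)" if "j < J" for j
      using uniform_index_integral[OF v[OF that] n] by simp
    have int: "integrable M (\<lambda>\<omega>. ?h x (?F x \<omega>))" if "x \<in> K <+> {..<J}" for x
      using that sgn idx unfolding has_bochner_integral_iff by blast
    have fin': "finite (K <+> {..<J})"
      using fin by simp
    have "has_bochner_integral M (\<lambda>\<omega>. \<Prod>x\<in>K <+> {..<J}. ?h x (?F x \<omega>))
        (\<Prod>x\<in>K <+> {..<J}. expectation (\<lambda>\<omega>. ?h x (?F x \<omega>)))"
      unfolding has_bochner_integral_iff
      using indep_vars_lebesgue_integral[OF fin' ind int] indep_vars_integrable[OF fin' ind int] by simp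
    also have "(\<Prod>x\<in>K <+> {..<J}. expectation (\<lambda>\<omega>. ?h x (?F x \<omega>)))
        = (\<Prod>k\<in>K. prob {\<omega>\<in>space M. d k \<omega> = \<sigma> k}) * ((\<Sum>i<n. f i) / n) ^ J"
    proof -
      have "(\<Prod>k\<in>K. expectation (\<lambda>\<omega>. ?h (Inl k) (?F (Inl k) \<omega>))) = (\<Prod>k\<in>K. prob {\<omega>\<in>space M. d k \<omega> = \<sigma> k})"
        by (intro prod.cong refl has_bochner_integral_integral_eq sgn)
      moreover have "(\<Prod>j<J. expectation (\<lambda>\<omega>. ?h (Inr j) (?F (Inr j) \<omega>))) = (\<Prod>j<J. (\<Sum>i<n. f i) / n)"
        by (intro prod.cong refl has_bochner_integral_integral_eq idx) simp
      ultimately show ?thesis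
        using fin by (simp add: prod.Plus)
    qed
    also have "has_bochner_integral M (\<lambda>\<omega>. \<Prod>x\<in>K <+> {..<J}. ?h x (?F x \<omega>)) =
        has_bochner_integral M (\<lambda>\<omega>. indicator ?A \<omega> * (\<Prod>j<J. f (v j \<omega>)))"
    proof (intro ext has_bochner_integral_cong refl)
      fix \<omega> assume "\<omega> \<in> space M"
      have "(\<Prod>k\<in>K. indicator {\<sigma> k} (d k \<omega>)) = (indicator ?A \<omega> :: real)"
        using \<open>\<omega> \<in> space M\<close> fin by (auto simp: indicator_def prod_zero_iff)
      then show "(\<Prod>x\<in>K <+> {..<J}. ?h x (?F x \<omega>)) = indicator ?A \<omega> * (\<Prod>j<J. f (v j \<omega>))"
        using fin by (simp add: prod.Plus)
    qed
    finally show ?thesis .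
  qed
  have "has_bochner_integral M (indicator ?A) (prob ?A)"
    using A by (intro has_bochner_integral_real_indicator) (auto simp: less_top[symmetric])
  \<comment> \<open>With \<open>f = 1\<close> the product formula gives the probability of the pattern itself.\<close>
  with *[of "\<lambda>_. 1"] have "(\<Prod>k\<in>K. prob {\<omega>\<in>space M. d k \<omega> = \<sigma> k}) = prob ?A"
    using n by (simp add: has_bochner_integral_eq)
  with *[of f] show ?thesis
    by simp
qed

text \<open>
  Chernoff's argument with the exponents \<open>s = \<epsilon> / 2\<close> and \<open>s = - \<epsilon> / 2\<close>, carried out on the event that
  the signs follow the pattern \<open>\<sigma>\<close>; the probability of that event survives as a factor.
\<close>

lemma sampling_tail_on_pattern:
  fixes d :: "'k \<Rightarrow> 'a \<Rightarrow> real" and \<sigma> :: "'k \<Rightarrow> real" and v :: "nat \<Rightarrow> 'a \<Rightarrow> nat" and g :: "nat \<Rightarrow> real"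
  assumes fin: "finite K"
    and indep: "indep_vars (\<lambda>_. borel) (case_sum d (\<lambda>j \<omega>. real (v j \<omega>))) (K <+> {..<J})"
    and v: "\<And>j. j < J \<Longrightarrow> uniform_index M n (v j)" and n: "0 < n"
    and m: "0 < m" and g: "\<And>i. i < n \<Longrightarrow> 0 \<le> g i \<and> g i \<le> m" and mean: "(\<Sum>i<n. g i) = n"
    and \<epsilon>: "0 < \<epsilon>" "\<epsilon> < 1"
  defines "A \<equiv> {\<omega>\<in>space M. \<forall>k\<in>K. d k \<omega> = \<sigma> k}"
  defines "B \<equiv> {\<omega>\<in>A. \<epsilon> * J < \<bar>(\<Sum>j<J. g (v j \<omega>)) - J\<bar>}"
  shows "B \<in> events" and "prob B \<le> 2 * exp (- (J * \<epsilon>\<^sup>2 / (4 * m))) * prob A"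
proof -
  have [measurable]: "v j \<in> measurable M (count_space UNIV)" if "j < J" for j
    using v[OF that] by (simp add: uniform_index_def)
  have [measurable]: "d k \<in> borel_measurable M" if "k \<in> K" for k
    using indep_vars_rv[OF indep InlI[OF that]] by simp
  have A [measurable]: "A \<in> events"
    unfolding A_def by measurable (use fin in \<open>auto simp: countable_finite\<close>)
  have G [measurable]: "(\<lambda>\<omega>. \<Sum>j<J. g (v j \<omega>)) \<in> borel_measurable M"
    by measurable
  \<comment> \<open>For positive \<open>s\<close> the upper and for negative \<open>s\<close> the lower deviation.\<close>
  define C where "C s = {\<omega>\<in>space M. \<omega> \<in> A \<and> s * J + \<bar>s\<bar> * \<epsilon> * J \<le> s * (\<Sum>j<J. g (v j \<omega>))}" for s :: real
  have C [measurable]: "C s \<in> events" for s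
    unfolding C_def by measurable
  have "B = {\<omega>\<in>space M. \<omega> \<in> A \<and> \<epsilon> * J < \<bar>(\<Sum>j<J. g (v j \<omega>)) - J\<bar>}"
    by (auto simp: B_def A_def)
  also have "\<dots> \<in> events"
    by measurable
  finally show "B \<in> events" .
  have tail: "prob (C s) \<le> exp (J * (s\<^sup>2 - \<bar>s\<bar> * \<epsilon>) / m) * prob A" if s: "\<bar>s\<bar> \<le> 1" for s :: real
  proof -
    let ?f = "\<lambda>i. exp (s * g i / m)" and ?t = "exp (- ((s * J + \<bar>s\<bar> * \<epsilon> * J) / m))"
    have E: "has_bochner_integral M (\<lambda>\<omega>. indicator A \<omega> * (\<Prod>j<J. ?f (v j \<omega>)))
        (prob A * ((\<Sum>i<n. ?f i) / n) ^ J)"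
      unfolding A_def by (rule expectation_on_pattern[OF fin indep v n])
    have "prob (C s) = expectation (indicator (C s))"
      using C by simp
    also have "\<dots> \<le> expectation (\<lambda>\<omega>. (indicator A \<omega> * (\<Prod>j<J. ?f (v j \<omega>))) * ?t)"
    proof (rule integral_mono)
      show "integrable M (indicator (C s) :: 'a \<Rightarrow> real)"
        by (simp add: less_top[symmetric])
      show "integrable M (\<lambda>\<omega>. (indicator A \<omega> * (\<Prod>j<J. ?f (v j \<omega>))) * ?t)"
        using E by (simp add: has_bochner_integral_iff)
      fix \<omega> assume "\<omega> \<in> space M"
      have "(\<Prod>j<J. ?f (v j \<omega>)) * ?t = exp ((s * (\<Sum>j<J. g (v j \<omega>)) - (s * J + \<bar>s\<bar> * \<epsilon> * J)) / m)"
        by (simp add: exp_sum[symmetric] exp_add[symmetric] sum_distrib_left sum_divide_distrib diff_divide_distrib)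
      moreover have "1 \<le> \<dots>" if "\<omega> \<in> C s"
        using that m by (simp add: C_def)
      ultimately show "indicator (C s) \<omega> \<le> (indicator A \<omega> * (\<Prod>j<J. ?f (v j \<omega>))) * ?t"
        by (auto simp: indicator_def C_def)
    qed
    also have "\<dots> = prob A * (((\<Sum>i<n. ?f i) / n) ^ J * ?t)"
      using E by (simp add: has_bochner_integral_iff)
    also have "\<dots> \<le> prob A * (exp ((s + s\<^sup>2) / m) ^ J * ?t)"
      by (intro mult_right_mono mult_left_mono power_mono average_exp_le[OF n m g mean s])
         (auto intro!: divide_nonneg_nonneg sum_nonneg)
    also have "exp ((s + s\<^sup>2) / m) ^ J * ?t = exp (J * (s\<^sup>2 - \<bar>s\<bar> * \<epsilon>) / m)"
      by (simp add: exp_of_nat_mult[symmetric] exp_add[symmetric] algebra_simps add_divide_distrib diff_divide_distrib)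
    finally show ?thesis
      by (simp add: mult_ac)
  qed
  have "B \<subseteq> C (\<epsilon> / 2) \<union> C (- (\<epsilon> / 2))"
  proof
    fix \<omega> assume \<omega>: "\<omega> \<in> B"
    let ?S = "\<Sum>j<J. g (v j \<omega>)"
    have *: "\<omega> \<in> A" "\<omega> \<in> space M" "\<epsilon> * J < \<bar>?S - J\<bar>"
      using \<omega> by (auto simp: B_def A_def)
    show "\<omega> \<in> C (\<epsilon> / 2) \<union> C (- (\<epsilon> / 2))"
    proof (cases "0 \<le> ?S - J")
      case True
      then have "\<epsilon> / 2 * (J + \<epsilon> * J) \<le> \<epsilon> / 2 * ?S"
        using * \<epsilon> by (intro mult_left_mono) auto
      then show ?thesis
        using * \<epsilon> by (simp add: C_def algebra_simps)
    next
      case False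
      then have "\<epsilon> / 2 * (?S + \<epsilon> * J) \<le> \<epsilon> / 2 * J"
        using * \<epsilon> by (intro mult_left_mono) auto
      then show ?thesis
        using * \<epsilon> by (simp add: C_def algebra_simps)
    qed
  qed
  then have "prob B \<le> prob (C (\<epsilon> / 2) \<union> C (- (\<epsilon> / 2)))"
    by (intro finite_measure_mono) auto
  also have "\<dots> \<le> prob (C (\<epsilon> / 2)) + prob (C (- (\<epsilon> / 2)))"
    by (intro measure_Un_le) auto
  also have "\<dots> \<le> exp (- (J * \<epsilon>\<^sup>2 / (4 * m))) * prob A + exp (- (J * \<epsilon>\<^sup>2 / (4 * m))) * prob A"
  proof -
    have e: "J * ((\<epsilon> / 2)\<^sup>2 - \<epsilon> / 2 * \<epsilon>) / m = - (J * \<epsilon>\<^sup>2 / (4 * m))"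
      using m by (simp add: power2_eq_square field_simps)
    show ?thesis
      by (rule add_mono) (use tail[of "\<epsilon> / 2"] tail[of "- (\<epsilon> / 2)"] \<epsilon> e in simp_all)
  qed
  finally show "prob B \<le> 2 * exp (- (J * \<epsilon>\<^sup>2 / (4 * m))) * prob A"
    by (simp add: mult_ac)
qed

text \<open>
  The function \<open>g\<close> to be sampled may depend on the signs. There are only finitely many patterns of
  signs, so the bounds on the single patterns add up, and the probabilities of the patterns add up
  to at most 1. The estimate is for any subset \<open>E\<close> of the bad event because that event itself is not
  known to be measurable for arbitrary \<open>good\<close> and \<open>g\<close>.
\<close>

lemma sampling_tail:
  fixes d :: "'k \<Rightarrow> 'a \<Rightarrow> real" and v :: "nat \<Rightarrow> 'a \<Rightarrow> nat"
    and good :: "('k \<Rightarrow> real) \<Rightarrow> bool" and g :: "('k \<Rightarrow> real) \<Rightarrow> nat \<Rightarrow> real"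
  assumes fin: "finite K"
    and indep: "indep_vars (\<lambda>_. borel) (case_sum d (\<lambda>j \<omega>. real (v j \<omega>))) (K <+> {..<J})"
    and rad: "\<And>k. k \<in> K \<Longrightarrow> rademacher M (d k)"
    and v: "\<And>j. j < J \<Longrightarrow> uniform_index M n (v j)" and n: "0 < n"
    and \<epsilon>: "0 < \<epsilon>" "\<epsilon> < 1" and m: "0 < m"
    and g: "\<And>\<sigma> i. good \<sigma> \<Longrightarrow> \<sigma> \<in> K \<rightarrow>\<^sub>E {1, - 1} \<Longrightarrow> i < n \<Longrightarrow> 0 \<le> g \<sigma> i \<and> g \<sigma> i \<le> m"
    and mean: "\<And>\<sigma>. good \<sigma> \<Longrightarrow> \<sigma> \<in> K \<rightarrow>\<^sub>E {1, - 1} \<Longrightarrow> (\<Sum>i<n. g \<sigma> i) = n"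
    and E: "E \<subseteq> {\<omega>\<in>space M. good (\<lambda>k\<in>K. d k \<omega>) \<and>
      \<epsilon> * J < \<bar>(\<Sum>j<J. g (\<lambda>k\<in>K. d k \<omega>) (v j \<omega>)) - J\<bar>}"
  shows "prob E \<le> 2 * exp (- (J * \<epsilon>\<^sup>2 / (4 * m)))" (is "_ \<le> ?b")
proof -
  have [measurable]: "d k \<in> borel_measurable M" if "k \<in> K" for k
    using rad[OF that] by (simp add: rademacher_def)
  define S where "S = {\<sigma> \<in> K \<rightarrow>\<^sub>E {1, - 1}. good \<sigma>}"
  have S: "finite S"
    unfolding S_def by (intro finite_subset[OF _ finite_PiE[OF fin, of "\<lambda>_. {1, - 1}"]]) auto
  define A where "A \<sigma> = {\<omega>\<in>space M. \<forall>k\<in>K. d k \<omega> = \<sigma> k}" for \<sigma>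
  define B where "B \<sigma> = {\<omega>\<in>A \<sigma>. \<epsilon> * J < \<bar>(\<Sum>j<J. g \<sigma> (v j \<omega>)) - J\<bar>}" for \<sigma>
  define Z where "Z = {\<omega>\<in>space M. \<not> (\<forall>k\<in>K. d k \<omega> = 1 \<or> d k \<omega> = - 1)}"
  have A: "A \<sigma> \<in> events" for \<sigma>
    unfolding A_def by measurable (use fin in \<open>auto simp: countable_finite\<close>)
  have Z: "Z \<in> events"
    unfolding Z_def by measurable (use fin in \<open>auto simp: countable_finite\<close>)
  have "AE \<omega> in M. \<forall>k\<in>K. d k \<omega> = 1 \<or> d k \<omega> = - 1"
    by (rule AE_finite_allI[OF fin rademacher_AE[OF rad]])
  then have Z0: "prob Z = 0"
    using Z unfolding Z_def by (subst prob_Collect_eq_0) auto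
  have B: "B \<sigma> \<in> events" "prob (B \<sigma>) \<le> ?b * prob (A \<sigma>)" if "\<sigma> \<in> S" for \<sigma>
    unfolding B_def A_def
    by (intro sampling_tail_on_pattern[OF fin indep v n m _ _ \<epsilon>] g mean;
        use that in \<open>auto simp: S_def\<close>)+
  have "prob (\<Union>\<sigma>\<in>S. B \<sigma>) \<le> (\<Sum>\<sigma>\<in>S. prob (B \<sigma>))"
    using B S by (intro finite_measure_subadditive_finite) auto
  also have "\<dots> \<le> (\<Sum>\<sigma>\<in>S. ?b * prob (A \<sigma>))"
    by (intro sum_mono B)
  also have "\<dots> = ?b * prob (\<Union>\<sigma>\<in>S. A \<sigma>)"
  proof -
    have "\<sigma> = \<tau>" if "\<sigma> \<in> S" "\<tau> \<in> S" "\<omega> \<in> A \<sigma>" "\<omega> \<in> A \<tau>" for \<sigma> \<tau> \<omega>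
      by (rule PiE_ext[of \<sigma> K "\<lambda>_. {1, - 1}" \<tau>]) (use that in \<open>auto simp: S_def A_def\<close>)
    then have "disjoint_family_on A S"
      unfolding disjoint_family_on_def by blast
    then have "prob (\<Union>\<sigma>\<in>S. A \<sigma>) = (\<Sum>\<sigma>\<in>S. prob (A \<sigma>))"
      using A S by (intro finite_measure_finite_Union) auto
    then show ?thesis
      by (simp add: sum_distrib_left)
  qed
  also have "\<dots> \<le> ?b"
    by (simp add: mult_left_le)
  finally have UB: "prob (\<Union>\<sigma>\<in>S. B \<sigma>) \<le> ?b" .
  have "E \<subseteq> Z \<union> (\<Union>\<sigma>\<in>S. B \<sigma>)"
  proof
    fix \<omega> assume \<omega>: "\<omega> \<in> E"
    define \<sigma> where "\<sigma> = (\<lambda>k\<in>K. d k \<omega>)"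
    show "\<omega> \<in> Z \<union> (\<Union>\<sigma>\<in>S. B \<sigma>)"
    proof (cases "\<omega> \<in> Z")
      case False
      then have "\<sigma> \<in> K \<rightarrow>\<^sub>E {1, - 1}"
        using \<omega> E by (auto simp: Z_def \<sigma>_def)
      then have "\<sigma> \<in> S"
        using \<omega> E by (auto simp: S_def \<sigma>_def)
      moreover have "\<omega> \<in> B \<sigma>"
        using \<omega> E by (auto simp: B_def A_def \<sigma>_def)
      ultimately show ?thesis
        by blast
    qed simp
  qed
  then have "prob E \<le> prob (Z \<union> (\<Union>\<sigma>\<in>S. B \<sigma>))"
    using Z B S by (intro finite_measure_mono) auto
  also have "\<dots> \<le> prob Z + prob (\<Union>\<sigma>\<in>S. B \<sigma>)"
    using Z B S by (intro measure_Un_le) auto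
  finally show ?thesis
    using Z0 UB by simp
qed

end

lemma kron_mats_cong:
  "(\<And>p. p \<in> {1..P} \<Longrightarrow> A p = B p) \<Longrightarrow> kron_mats A P = kron_mats B P"
  by (induction P) auto

lemma hadamard_transform_cong:
  assumes "\<And>i. i < n \<Longrightarrow> s i = s' i"
  shows "hadamard_transform n s = hadamard_transform n s'"
proof -
  have "mat_diag n s = mat_diag n s'"
    unfolding mat_diag_def by (rule eq_matI) (use assms in auto)
  then show ?thesis
    by (simp add: hadamard_transform_def)
qed

section \<open>The sampled transform\<close>

lemma l2_norm_sq_diff:
  assumes "dim_vec x = dim_vec y"
  shows "(l2_norm (x - y))\<^sup>2 = comb_sq 1 x (- 1) y"
  using assms by (simp add: l2_norm_def L2_set_def comb_sq_def sum_nonneg)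

lemma sampling_mat_mult_vec:
  assumes "z \<in> carrier_vec n" and "j < J"
  shows "(sampling_mat J n v *\<^sub>v z) $ j = sqrt (n / J) * (if v j < n then z $ v j else 0)"
proof -
  have "unit_vec n (v j) \<bullet> z = (if v j < n then z $ v j else 0)"
  proof (cases "v j < n")
    case False
    then have "unit_vec n (v j) = (0\<^sub>v n :: real Matrix.vec)"
      by (intro eq_vecI) (auto simp: unit_vec_def)
    then show ?thesis
      using assms False by simp
  qed (use assms in simp)
  then show ?thesis
    using assms by (simp add: sampling_mat_def)
qed

lemma l2_norm_sq_sampled:
  assumes "z \<in> carrier_vec n" and "z' \<in> carrier_vec n"
  shows "(l2_norm (sampling_mat J n v *\<^sub>v z - sampling_mat J n v *\<^sub>v z'))\<^sup>2
    = n / J * (\<Sum>j<J. if v j < n then (z $ v j - z' $ v j)\<^sup>2 else 0)"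
proof -
  have dim: "dim_row (sampling_mat J n v) = J"
    by (simp add: sampling_mat_def)
  have "(l2_norm (sampling_mat J n v *\<^sub>v z - sampling_mat J n v *\<^sub>v z'))\<^sup>2
      = comb_sq 1 (sampling_mat J n v *\<^sub>v z) (- 1) (sampling_mat J n v *\<^sub>v z')"
    by (rule l2_norm_sq_diff) simp
  also have "\<dots> = (\<Sum>j<J. (sqrt (n / J) * (if v j < n then z $ v j - z' $ v j else 0))\<^sup>2)"
    unfolding comb_sq_def dim_mult_mat_vec dim
    by (intro sum.cong refl) (use assms in \<open>simp add: sampling_mat_mult_vec del: index_mult_mat_vec, simp add: algebra_simps\<close>)
  also have "\<dots> = (\<Sum>j<J. n / J * (if v j < n then (z $ v j - z' $ v j)\<^sup>2 else 0))"
    by (intro sum.cong refl) (simp add: power_mult_distrib)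
  finally show ?thesis
    by (simp add: sum_distrib_left)
qed

lemma matrix_row_coherence:
  assumes A: "A \<in> carrier_mat n n" and "dim_vec x = n" and "dim_vec y = n" and "i < n"
    and ef: "\<And>r a b. (a * (\<Sum>j<n. r j * x $ j) + b * (\<Sum>j<n. r j * y $ j))\<^sup>2
      \<le> ((\<Sum>j<n. r j * e j)\<^sup>2 + (\<Sum>j<n. r j * f j)\<^sup>2) * (\<Sum>j<n. (a * x $ j + b * y $ j)\<^sup>2)"
  shows "(a * (A *\<^sub>v x) $ i + b * (A *\<^sub>v y) $ i)\<^sup>2
    \<le> ((\<Sum>j<n. A $$ (i, j) * e j)\<^sup>2 + (\<Sum>j<n. A $$ (i, j) * f j)\<^sup>2) * comb_sq a x b y"
  using ef[of a "\<lambda>j. A $$ (i, j)" b] assms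
  by (auto simp: scalar_prod_def atLeast0LessThan comb_sq_def)

lemma kron_vecs_measurable:
  assumes "\<And>p \<omega>. p \<in> {1..P} \<Longrightarrow> dim_vec (u \<omega> p) = I p"
    and "\<And>p i. p \<in> {1..P} \<Longrightarrow> i < I p \<Longrightarrow> (\<lambda>\<omega>. u \<omega> p $ i) \<in> borel_measurable M"
    and "k < (\<Prod>p=1..P. I p)"
  shows "(\<lambda>\<omega>. kron_vecs (u \<omega>) P $ k) \<in> borel_measurable M"
  using assms
proof (induction P arbitrary: k)
  case 0
  then show ?case by simp
next
  case (Suc P)
  let ?n = "I (Suc P)"
  have dim: "dim_vec (kron_vecs (u \<omega>) P) = (\<Prod>p=1..P. I p)" "dim_vec (u \<omega> (Suc P)) = ?n" for \<omega>
    by (rule dim_kron_vecs; use Suc.prems(1) in simp) (use Suc.prems(1) in simp)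
  have k: "k < (\<Prod>p=1..P. I p) * ?n"
    using Suc.prems(3) by simp
  then have j: "k mod ?n < ?n"
    by (cases "?n = 0") auto
  have i: "k div ?n < (\<Prod>p=1..P. I p)"
    using k by (simp add: less_mult_imp_div_less)
  have "(\<lambda>\<omega>. kron_vecs (u \<omega>) P $ (k div ?n) * u \<omega> (Suc P) $ (k mod ?n)) \<in> borel_measurable M"
    by (intro borel_measurable_times Suc.IH Suc.prems i j) (use Suc.prems in auto)
  then show ?case
    using k by (simp add: kron_vec_index dim)
qed

section \<open>The Kronecker sketch\<close>

locale kronecker_fjlt = prob_space M for M :: "'a measure" +
  fixes P J :: nat and I :: "nat \<Rightarrow> nat"
    and d :: "nat \<Rightarrow> nat \<Rightarrow> 'a \<Rightarrow> real" and v :: "nat \<Rightarrow> 'a \<Rightarrow> nat"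
  assumes J: "1 \<le> J" and pow: "\<And>p. p \<in> {1..P} \<Longrightarrow> \<exists>k. I p = 2 ^ k"
    and signs: "\<And>p i. p \<in> {1..P} \<Longrightarrow> i < I p \<Longrightarrow> rademacher M (d p i)"
    and indices: "\<And>j. j < J \<Longrightarrow> uniform_index M (\<Prod>p=1..P. I p) (v j)"
    and indep: "indep_vars (\<lambda>_. borel) (case_sum (\<lambda>(p, i). d p i) (\<lambda>j \<omega>. real (v j \<omega>)))
      ((SIGMA p:{1..P}. {..<I p}) <+> {..<J})"
begin

definition total_dim :: nat where
  "total_dim = (\<Prod>p=1..P. I p)"

definition sign_positions :: "(nat \<times> nat) set" where
  "sign_positions = (SIGMA p:{1..P}. {..<I p})"

text \<open>
  The factors and their product are functions of the pattern of signs, not of the outcome, so that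
  they can be studied for one fixed pattern at a time.
\<close>

definition factor :: "(nat \<times> nat \<Rightarrow> real) \<Rightarrow> nat \<Rightarrow> real Matrix.mat" where
  "factor \<sigma> p = hadamard_transform (I p) (\<lambda>i. \<sigma> (p, i))"

definition transform :: "(nat \<times> nat \<Rightarrow> real) \<Rightarrow> real Matrix.mat" where
  "transform \<sigma> = kron_mats (factor \<sigma>) P"

definition sketch :: "'a \<Rightarrow> real Matrix.vec \<Rightarrow> real Matrix.vec" where
  "sketch \<omega> x = sampling_mat J total_dim (\<lambda>j. v j \<omega>) *\<^sub>v (transform (\<lambda>(p, i). d p i \<omega>) *\<^sub>v x)"

lemma finite_sign_positions: "finite sign_positions"
  by (simp add: sign_positions_def)

lemma I_pos: "p \<in> {1..P} \<Longrightarrow> 0 < I p"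
  using pow by fastforce

lemma total_dim_pos: "0 < total_dim"
  unfolding total_dim_def by (intro prod_pos) (auto simp: I_pos)

lemma factor_carrier: "p \<in> {1..P} \<Longrightarrow> factor \<sigma> p \<in> carrier_mat (I p) (I p)"
  unfolding factor_def using pow[of p] hadamard_transform_carrier by fastforce

lemma transform_carrier: "transform \<sigma> \<in> carrier_mat total_dim total_dim"
  unfolding transform_def total_dim_def by (intro kron_mats_carrier factor_carrier)

lemma transform_restrict: "transform (restrict \<sigma> sign_positions) = transform \<sigma>"
  unfolding transform_def factor_def
  by (intro kron_mats_cong hadamard_transform_cong) (simp add: sign_positions_def)

lemma transform_mult_kron_vecs:
  assumes "\<And>p. p \<in> {1..P} \<Longrightarrow> dim_vec (xs p) = I p"
  shows "transform \<sigma> *\<^sub>v kron_vecs xs P = kron_vecs (\<lambda>p. factor \<sigma> p *\<^sub>v xs p) P"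
  unfolding transform_def using factor_carrier assms by (rule kron_mats_mult_kron_vecs)

lemma l2_norm_sq_sketch:
  assumes "dim_vec x = total_dim" and "dim_vec y = total_dim"
  shows "(l2_norm (sketch \<omega> x - sketch \<omega> y))\<^sup>2
    = total_dim / J * (\<Sum>j<J. if v j \<omega> < total_dim then ((transform (\<lambda>(p, i). d p i \<omega>) *\<^sub>v x) $ v j \<omega>
        - (transform (\<lambda>(p, i). d p i \<omega>) *\<^sub>v y) $ v j \<omega>)\<^sup>2 else 0)"
  unfolding sketch_def
  by (intro l2_norm_sq_sampled mult_mat_vec_carrier[OF transform_carrier]) (use assms in \<open>auto intro: carrier_vecI\<close>)

lemma dim_kronecker_vector: "x \<in> kronecker_vectors I P \<Longrightarrow> dim_vec x = total_dim"
  unfolding kronecker_vectors_def total_dim_def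
  by (elim CollectE exE conjE, hypsubst, rule dim_kron_vecs) auto

lemma transform_entry_measurable:
  assumes "x \<in> kronecker_vectors I P" and "k < total_dim"
  shows "(\<lambda>\<omega>. (transform (\<lambda>(p, i). d p i \<omega>) *\<^sub>v x) $ k) \<in> borel_measurable M"
proof -
  obtain xs where x: "x = kron_vecs xs P" and xs: "\<And>p. p \<in> {1..P} \<Longrightarrow> dim_vec (xs p) = I p"
    using assms unfolding kronecker_vectors_def by auto
  have "(\<lambda>\<omega>. kron_vecs (\<lambda>p. factor (\<lambda>(p, i). d p i \<omega>) p *\<^sub>v xs p) P $ k) \<in> borel_measurable M"
  proof (rule kron_vecs_measurable)
    fix p \<omega> assume "p \<in> {1..P}"
    then show "dim_vec (factor (\<lambda>(p, i). d p i \<omega>) p *\<^sub>v xs p) = I p"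
      using factor_carrier[of p] by auto
  next
    fix p i assume p: "p \<in> {1..P}" and i: "i < I p"
    obtain l where l: "I p = 2 ^ l"
      using pow[OF p] by blast
    have [measurable]: "d p j \<in> borel_measurable M" if "j < 2 ^ l" for j
      using signs[OF p] that l by (simp add: rademacher_def)
    have "(\<lambda>\<omega>. \<Sum>j<2 ^ l. hadamard_mat (2 ^ l) $$ (i, j) * d p j \<omega> * xs p $ j) \<in> borel_measurable M"
      by measurable
    then show "(\<lambda>\<omega>. (factor (\<lambda>(p, i). d p i \<omega>) p *\<^sub>v xs p) $ i) \<in> borel_measurable M"
      using i xs[OF p] by (simp add: factor_def l hadamard_transform_mult_vec del: index_mult_mat_vec)
  qed (use assms in \<open>simp add: total_dim_def\<close>)
  moreover have "transform \<sigma> *\<^sub>v x = kron_vecs (\<lambda>p. factor \<sigma> p *\<^sub>v xs p) P" for \<sigma>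
    unfolding x by (rule transform_mult_kron_vecs) (rule xs)
  ultimately show ?thesis
    by (simp only:)
qed

lemma sketch_measurable:
  assumes x: "x \<in> kronecker_vectors I P" and y: "y \<in> kronecker_vectors I P"
  shows "(\<lambda>\<omega>. (l2_norm (sketch \<omega> x - sketch \<omega> y))\<^sup>2) \<in> borel_measurable M"
proof -
  have "(\<lambda>\<omega>. if v j \<omega> < total_dim then ((transform (\<lambda>(p, i). d p i \<omega>) *\<^sub>v x) $ v j \<omega>
      - (transform (\<lambda>(p, i). d p i \<omega>) *\<^sub>v y) $ v j \<omega>)\<^sup>2 else 0) \<in> borel_measurable M" if "j < J" for j
  proof (rule measurable_compose_countable[where g = "v j"])
    show "v j \<in> measurable M (count_space UNIV)"
      using indices[OF that] by (simp add: uniform_index_def)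
    fix i :: nat
    show "(\<lambda>\<omega>. if i < total_dim then ((transform (\<lambda>(p, i). d p i \<omega>) *\<^sub>v x) $ i
      - (transform (\<lambda>(p, i). d p i \<omega>) *\<^sub>v y) $ i)\<^sup>2 else 0) \<in> borel_measurable M"
      by (cases "i < total_dim") (auto intro!: borel_measurable_power borel_measurable_diff
        transform_entry_measurable x y simp del: index_mult_mat_vec)
  qed
  then show ?thesis
    unfolding l2_norm_sq_sketch[OF dim_kronecker_vector[OF x] dim_kronecker_vector[OF y]]
    by (intro borel_measurable_times borel_measurable_sum) auto
qed

lemma indep_signs: "indep_vars (\<lambda>_. borel) (\<lambda>(p, i). d p i) sign_positions"
proof -
  let ?F = "case_sum (\<lambda>(p, i). d p i) (\<lambda>j \<omega>. real (v j \<omega>))"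
  have *: "indep_vars (\<lambda>_. borel) ?F (Inl ` sign_positions)"
    by (rule indep_vars_subset[OF indep]) (auto simp: sign_positions_def)
  have "indep_vars (\<lambda>_. borel) (\<lambda>k. ?F (Inl k)) sign_positions"
    by (rule indep_vars_reindex[OF *]) simp
  then show ?thesis
    by simp
qed

text \<open>
  All entries of a row of the Hadamard matrix have absolute value \<open>1 / \<surd>(I p)\<close>, so the inner product
  of a unit vector with a row of the transform is a Rademacher sum whose coefficients have squared
  norm \<open>1 / I p\<close>.
\<close>

lemma factor_row_tail:
  assumes p: "p \<in> {1..P}" and i: "i < I p" and e: "(\<Sum>j<I p. (e j)\<^sup>2) \<le> 1"
    and L: "0 < L"
  shows "prob {\<omega>\<in>space M. sqrt (2 * L / I p) \<le> \<bar>\<Sum>j<I p. factor (\<lambda>(p, i). d p i \<omega>) p $$ (i, j) * e j\<bar>}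
    \<le> 2 * exp (- L)"
proof -
  obtain l where l: "I p = 2 ^ l"
    using pow[OF p] by blast
  let ?T = "Pair p ` {..<I p}" and ?c = "\<lambda>(_, j). hadamard_mat (I p) $$ (i, j) * e j"
  have ind: "indep_vars (\<lambda>_. borel) (\<lambda>(p, i). d p i) ?T"
    by (rule indep_vars_subset[OF indep_signs]) (use p in \<open>auto simp: sign_positions_def\<close>)
  have inj: "inj_on (Pair p) {..<I p}"
    by (simp add: inj_on_def)
  have "(\<Sum>k\<in>?T. (?c k)\<^sup>2) = (\<Sum>j<I p. (hadamard_mat (I p) $$ (i, j))\<^sup>2 * (e j)\<^sup>2)"
    by (simp add: sum.reindex[OF inj] power_mult_distrib)
  also have "\<dots> = (\<Sum>j<I p. 1 / I p * (e j)\<^sup>2)"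
    by (intro sum.cong refl) (use i in \<open>simp add: l hadamard_mat_entry_sq\<close>)
  also have "\<dots> \<le> 1 / I p"
    unfolding sum_distrib_left[symmetric] using e I_pos[OF p] by (simp add: field_simps)
  finally have c: "(\<Sum>k\<in>?T. (?c k)\<^sup>2) \<le> 1 / I p" .
  have eq: "(\<Sum>k\<in>?T. ?c k * (\<lambda>(p, i). d p i) k \<omega>)
      = (\<Sum>j<I p. factor (\<lambda>(p, i). d p i \<omega>) p $$ (i, j) * e j)" for \<omega>
    unfolding sum.reindex[OF inj]
    by (intro sum.cong refl) (use i in \<open>simp add: l factor_def hadamard_transform_entry\<close>)
  have "prob {\<omega>\<in>space M. sqrt (2 * L / I p) \<le> \<bar>\<Sum>k\<in>?T. ?c k * (\<lambda>(p, i). d p i) k \<omega>\<bar>}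
      \<le> 2 * exp (- ((sqrt (2 * L / I p))\<^sup>2 / (2 * (1 / I p))))"
    using c by (rule rademacher_sum_tail[rotated 3])
       (use ind p signs L I_pos[OF p] in auto)
  also have "(sqrt (2 * L / I p))\<^sup>2 / (2 * (1 / I p)) = L"
    using L I_pos[OF p] by simp
  finally show ?thesis
    unfolding eq .
qed

end

context kronecker_fjlt
begin

text \<open>
  Each of the \<open>P\<close> factors, and the sampling, is allotted the failure probability \<open>\<eta>\<close>. In factor \<open>p\<close>
  there are \<open>I p\<close> rows and two basis vectors with two-sided tails, so each single tail must be
  \<open>\<eta> / (4 I p) = exp (- L p)\<close>. If no factor fails, the squared inner products of the rows with the
  two basis vectors are below \<open>2 L p / I p\<close> each, and by \<open>kron_vecs_coherence\<close> the \<open>total_dim\<close>-fold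
  squared entries of the transformed difference are at most \<open>m\<close> times its squared norm, where
  \<open>m = 4 ^ P * (\<Prod>p=1..P. L p)\<close>. This is the quantity that the required number of samples is
  proportional to.
\<close>

lemma pair_failure:
  fixes \<epsilon> \<eta> :: real
  assumes x: "x \<in> kronecker_vectors I P" and y: "y \<in> kronecker_vectors I P"
    and \<epsilon>: "0 < \<epsilon>" "\<epsilon> < 1" and \<eta>: "0 < \<eta>" "\<eta> < 1"
    and J_large: "real J > 16 / 3 * 4 ^ P * (1 / \<epsilon>\<^sup>2) * ln (4 / \<eta>) * (\<Prod>p=1..P. ln (4 * real (I p) / \<eta>))"
  shows "prob {\<omega>\<in>space M. \<not> ((1 - \<epsilon>) * (l2_norm (x - y))\<^sup>2 \<le> (l2_norm (sketch \<omega> x - sketch \<omega> y))\<^sup>2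
    \<and> (l2_norm (sketch \<omega> x - sketch \<omega> y))\<^sup>2 \<le> (1 + \<epsilon>) * (l2_norm (x - y))\<^sup>2)} \<le> (P + 1) * \<eta>"
    (is "prob {\<omega>\<in>space M. \<not> ?ok \<omega>} \<le> _")
proof -
  have dx: "dim_vec x = total_dim" and dy: "dim_vec y = total_dim"
    using x y by (simp_all add: dim_kronecker_vector)
  define c where "c = comb_sq 1 x (- 1) y"
  have c: "(l2_norm (x - y))\<^sup>2 = c"
    unfolding c_def by (rule l2_norm_sq_diff) (simp add: dx dy)
  show ?thesis
  proof (cases "c = 0")
    case True
    then have "x = y"
      by (intro eq_vecI) (simp_all add: c_def comb_sq_def sum_nonneg_eq_0_iff dx dy)
    moreover have "(l2_norm (z - z))\<^sup>2 = 0" for z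
      by (simp add: l2_norm_sq_diff comb_sq_def)
    ultimately have "{\<omega>\<in>space M. \<not> ?ok \<omega>} = {}"
      by simp
    then show ?thesis
      using \<eta> by (simp only: measure_empty) simp
  next
    case False
    then have c_pos: "0 < c"
      using comb_sq_nonneg[of 1 x "- 1" y] by (simp add: c_def)
    obtain xs where xs: "x = kron_vecs xs P" "\<And>p. p \<in> {1..P} \<Longrightarrow> dim_vec (xs p) = I p"
      using x unfolding kronecker_vectors_def by auto
    obtain ys where ys: "y = kron_vecs ys P" "\<And>p. p \<in> {1..P} \<Longrightarrow> dim_vec (ys p) = I p"
      using y unfolding kronecker_vectors_def by auto
    define spans where "spans p e f \<longleftrightarrow> (\<Sum>j<I p. (e j)\<^sup>2) \<le> 1 \<and> (\<Sum>j<I p. (f j)\<^sup>2) \<le> 1 \<and>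
      (\<forall>r a b. (a * (\<Sum>j<I p. r j * xs p $ j) + b * (\<Sum>j<I p. r j * ys p $ j))\<^sup>2
      \<le> ((\<Sum>j<I p. r j * e j)\<^sup>2 + (\<Sum>j<I p. r j * f j)\<^sup>2)
        * (\<Sum>j<I p. (a * xs p $ j + b * ys p $ j)\<^sup>2))" for p and e f :: "nat \<Rightarrow> real"
    have "\<exists>e f. spans p e f" for p
      by (rule two_dim_coherence[of "I p" "\<lambda>j. xs p $ j" "\<lambda>j. ys p $ j"])
         (unfold spans_def, blast)
    then obtain e f where spans: "\<And>p. spans p (e p) (f p)"
      by metis
    have e: "(\<Sum>j<I p. (e p j)\<^sup>2) \<le> 1" for p
      using spans[of p] unfolding spans_def by (elim conjE)
    have f: "(\<Sum>j<I p. (f p j)\<^sup>2) \<le> 1" for p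
      using spans[of p] unfolding spans_def by (elim conjE)
    have ef: "(a * (\<Sum>j<I p. r j * xs p $ j) + b * (\<Sum>j<I p. r j * ys p $ j))\<^sup>2
        \<le> ((\<Sum>j<I p. r j * e p j)\<^sup>2 + (\<Sum>j<I p. r j * f p j)\<^sup>2)
          * (\<Sum>j<I p. (a * xs p $ j + b * ys p $ j)\<^sup>2)" for p r a b
      using spans[of p] unfolding spans_def by (elim conjE allE)
    define L where "L p = ln (4 * real (I p) / \<eta>)" for p
    define t where "t p = sqrt (2 * L p / I p)" for p
    define m where "m = 4 ^ P * (\<Prod>p=1..P. L p)"
    have L: "0 < L p" if "p \<in> {1..P}" for p
    proof -
      have "1 < 4 * real (I p) / \<eta>"
        using I_pos[OF that] \<eta> by (simp add: field_simps)
      then show ?thesis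
        by (simp add: L_def)
    qed
    have m: "0 < m"
      unfolding m_def by (intro mult_pos_pos prod_pos) (auto simp: L)
    define good where "good \<sigma> \<longleftrightarrow> (\<forall>p\<in>{1..P}. \<forall>i<I p.
        \<bar>\<Sum>j<I p. factor \<sigma> p $$ (i, j) * e p j\<bar> < t p \<and> \<bar>\<Sum>j<I p. factor \<sigma> p $$ (i, j) * f p j\<bar> < t p)" for \<sigma>
    \<comment> \<open>The squared entries of the transformed difference, scaled to have average 1.\<close>
    define g where "g \<sigma> i = (if i < total_dim then total_dim / c *
        ((transform \<sigma> *\<^sub>v x) $ i - (transform \<sigma> *\<^sub>v y) $ i)\<^sup>2 else 0)" for \<sigma> i
    have Tx: "transform \<sigma> *\<^sub>v x = kron_vecs (\<lambda>p. factor \<sigma> p *\<^sub>v xs p) P"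
      and Ty: "transform \<sigma> *\<^sub>v y = kron_vecs (\<lambda>p. factor \<sigma> p *\<^sub>v ys p) P" for \<sigma>
      unfolding xs(1) ys(1) by (rule transform_mult_kron_vecs; rule xs(2) ys(2); assumption)+
    have dims: "dim_vec (xs p) = I p \<and> dim_vec (ys p) = I p"
      "dim_vec (factor \<sigma> p *\<^sub>v xs p) = I p \<and> dim_vec (factor \<sigma> p *\<^sub>v ys p) = I p" if "p \<in> {1..P}" for \<sigma> p
      using xs(2)[OF that] ys(2)[OF that] factor_carrier[OF that, of \<sigma>] by auto
    have g_bound: "0 \<le> g \<sigma> i \<and> g \<sigma> i \<le> m" if \<sigma>: "good \<sigma>" and i: "i < total_dim" for \<sigma> i
    proof -
      have "(1 * (transform \<sigma> *\<^sub>v x) $ i + - 1 * (transform \<sigma> *\<^sub>v y) $ i)\<^sup>2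
          \<le> (\<Prod>p=1..P. 4 * L p / I p) * comb_sq 1 (kron_vecs xs P) (- 1) (kron_vecs ys P)"
        unfolding Tx Ty
      proof (rule kron_vecs_coherence)
        fix p i a b assume p: "p \<in> {1..P}" and i: "i < I p"
        let ?E = "\<Sum>j<I p. factor \<sigma> p $$ (i, j) * e p j" and ?F = "\<Sum>j<I p. factor \<sigma> p $$ (i, j) * f p j"
        have "(a * (factor \<sigma> p *\<^sub>v xs p) $ i + b * (factor \<sigma> p *\<^sub>v ys p) $ i)\<^sup>2
            \<le> (?E\<^sup>2 + ?F\<^sup>2) * comb_sq a (xs p) b (ys p)"
          by (rule matrix_row_coherence[OF factor_carrier[OF p] _ _ i ef]) (simp_all only: dims(1)[OF p])
        also have "\<dots> \<le> ((t p)\<^sup>2 + (t p)\<^sup>2) * comb_sq a (xs p) b (ys p)"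
        proof (intro mult_right_mono add_mono comb_sq_nonneg)
          have "\<bar>?E\<bar> < t p" "\<bar>?F\<bar> < t p"
            using \<sigma> p i unfolding good_def by blast+
          then show "?E\<^sup>2 \<le> (t p)\<^sup>2" "?F\<^sup>2 \<le> (t p)\<^sup>2"
            by (intro abs_le_square_iff[THEN iffD1], linarith)+
        qed
        also have "(t p)\<^sup>2 + (t p)\<^sup>2 = 4 * L p / I p"
          using L[OF p] by (simp add: t_def)
        finally show "(a * (factor \<sigma> p *\<^sub>v xs p) $ i + b * (factor \<sigma> p *\<^sub>v ys p) $ i)\<^sup>2
            \<le> 4 * L p / I p * comb_sq a (xs p) b (ys p)" .
      next
        fix p assume "p \<in> {1..P}"
        then show "0 \<le> 4 * L p / I p"
          using L[of p] by simp
      qed (use dims i in \<open>simp_all add: total_dim_def\<close>)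
      also have "(\<Prod>p=1..P. 4 * L p / I p) = m / total_dim"
        by (simp add: m_def total_dim_def prod_dividef prod.distrib)
      also have "comb_sq 1 (kron_vecs xs P) (- 1) (kron_vecs ys P) = c"
        by (simp add: c_def xs(1) ys(1))
      finally have "((transform \<sigma> *\<^sub>v x) $ i - (transform \<sigma> *\<^sub>v y) $ i)\<^sup>2 \<le> m / total_dim * c"
        by (simp del: index_mult_mat_vec)
      then have "g \<sigma> i \<le> total_dim / c * (m / total_dim * c)"
        unfolding g_def if_P[OF i] using c_pos by (intro mult_left_mono) auto
      also have "\<dots> = m"
        using c_pos total_dim_pos by simp
      finally show ?thesis
        using c_pos by (simp add: g_def)
    qed
    have g_mean: "(\<Sum>i<total_dim. g \<sigma> i) = total_dim" if "\<sigma> \<in> sign_positions \<rightarrow>\<^sub>E {1, - 1}" for \<sigma>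
    proof -
      have "comb_sq 1 (transform \<sigma> *\<^sub>v x) (- 1) (transform \<sigma> *\<^sub>v y)
          = comb_sq 1 (kron_vecs xs P) (- 1) (kron_vecs ys P)"
        unfolding Tx Ty
      proof (rule kron_vecs_isometry)
        fix p a b assume p: "p \<in> {1..P}"
        obtain l where l: "I p = 2 ^ l"
          using pow[OF p] by blast
        have "(\<sigma> (p, j))\<^sup>2 = 1" if "j < 2 ^ l" for j
          using \<open>\<sigma> \<in> sign_positions \<rightarrow>\<^sub>E {1, - 1}\<close>[THEN PiE_mem, of "(p, j)"] that p l by (auto simp: sign_positions_def)
        then show "comb_sq a (factor \<sigma> p *\<^sub>v xs p) b (factor \<sigma> p *\<^sub>v ys p) = comb_sq a (xs p) b (ys p)"
          unfolding factor_def l using dims(1)[OF p] l by (intro hadamard_transform_isometry) auto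
      qed (use dims in auto)
      then have "(\<Sum>i<total_dim. ((transform \<sigma> *\<^sub>v x) $ i - (transform \<sigma> *\<^sub>v y) $ i)\<^sup>2) = c"
        using transform_carrier[of \<sigma>] unfolding c_def xs(1)[symmetric] ys(1)[symmetric]
        by (auto simp: comb_sq_def simp del: index_mult_mat_vec)
      moreover have "(\<Sum>i<total_dim. g \<sigma> i)
          = total_dim / c * (\<Sum>i<total_dim. ((transform \<sigma> *\<^sub>v x) $ i - (transform \<sigma> *\<^sub>v y) $ i)\<^sup>2)"
        by (simp add: g_def sum_distrib_left del: index_mult_mat_vec)
      ultimately show ?thesis
        using c_pos by simp
    qed
    let ?\<sigma> = "\<lambda>\<omega>. \<lambda>(p, i). d p i \<omega>" and ?\<tau> = "\<lambda>\<omega>. \<lambda>k\<in>sign_positions. (\<lambda>(p, i). d p i) k \<omega>"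
    have restrict: "?\<tau> \<omega> = restrict (?\<sigma> \<omega>) sign_positions" for \<omega>
      by (auto simp: restrict_def)
    have factor_\<tau>: "factor (?\<tau> \<omega>) p = factor (?\<sigma> \<omega>) p" if "p \<in> {1..P}" for \<omega> p
      unfolding factor_def using that by (intro hadamard_transform_cong) (simp add: sign_positions_def)
    have transform_\<tau>: "transform (?\<tau> \<omega>) = transform (?\<sigma> \<omega>)" for \<omega>
      unfolding restrict by (rule transform_restrict)
    define G where "G \<omega> = (\<Sum>j<J. g (?\<tau> \<omega>) (v j \<omega>))" for \<omega>
    have norm: "(l2_norm (sketch \<omega> x - sketch \<omega> y))\<^sup>2 = c / J * G \<omega>" for \<omega>
      unfolding l2_norm_sq_sketch[OF dx dy] G_def g_def transform_\<tau> sum_distrib_left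
      using c_pos by (intro sum.cong refl) (simp del: index_mult_mat_vec)
    have ok: "?ok \<omega> \<longleftrightarrow> \<bar>G \<omega> - J\<bar> \<le> \<epsilon> * J" for \<omega>
    proof -
      have "?ok \<omega> \<longleftrightarrow> c / J * ((1 - \<epsilon>) * J) \<le> c / J * G \<omega> \<and> c / J * G \<omega> \<le> c / J * ((1 + \<epsilon>) * J)"
        unfolding norm c using J by (simp add: mult_ac)
      also have "\<dots> \<longleftrightarrow> (1 - \<epsilon>) * J \<le> G \<omega> \<and> G \<omega> \<le> (1 + \<epsilon>) * J"
        using c_pos J by (intro conj_cong mult_le_cancel_left_pos) auto
      also have "\<dots> \<longleftrightarrow> \<bar>G \<omega> - J\<bar> \<le> \<epsilon> * J"
        by (auto simp: abs_le_iff algebra_simps)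
      finally show ?thesis .
    qed
    let ?R = "\<lambda>p i u. {\<omega>\<in>space M. t p \<le> \<bar>\<Sum>j<I p. factor (?\<sigma> \<omega>) p $$ (i, j) * u p j\<bar>}"
    have R_event: "?R p i u \<in> events" if p: "p \<in> {1..P}" and i: "i < I p" for p i and u :: "nat \<Rightarrow> nat \<Rightarrow> real"
    proof -
      obtain l where l: "I p = 2 ^ l"
        using pow[OF p] by blast
      have [measurable]: "d p j \<in> borel_measurable M" if "j < 2 ^ l" for j
        using signs[OF p] that l by (simp add: rademacher_def)
      have "?R p i u = {\<omega>\<in>space M. t p \<le> \<bar>\<Sum>j<2 ^ l. hadamard_mat (2 ^ l) $$ (i, j) * d p j \<omega> * u p j\<bar>}"
        using i by (simp add: l factor_def hadamard_transform_entry)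
      also have "\<dots> \<in> events"
        by measurable
      finally show ?thesis .
    qed
    have R_prob: "prob (?R p i u) \<le> 2 * exp (- L p)"
      if "p \<in> {1..P}" "i < I p" "(\<Sum>j<I p. (u p j)\<^sup>2) \<le> 1" for p i and u :: "nat \<Rightarrow> nat \<Rightarrow> real"
      unfolding t_def using factor_row_tail[OF that L] that by simp
    let ?U = "\<Union>p\<in>{1..P}. \<Union>i<I p. ?R p i e \<union> ?R p i f"
    have U_event: "?U \<in> events"
      using R_event by (intro sets.finite_UN sets.Un) auto
    have "prob ?U \<le> (\<Sum>p=1..P. prob (\<Union>i<I p. ?R p i e \<union> ?R p i f))"
      using R_event by (intro finite_measure_subadditive_finite) (auto intro!: sets.finite_UN)
    also have "\<dots> \<le> (\<Sum>p=1..P. \<Sum>i<I p. prob (?R p i e \<union> ?R p i f))"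
      using R_event by (intro sum_mono finite_measure_subadditive_finite) auto
    also have "\<dots> \<le> (\<Sum>p=1..P. \<Sum>i<I p. 2 * exp (- L p) + 2 * exp (- L p))"
    proof (intro sum_mono)
      fix p i assume p: "p \<in> {1..P}" and i: "i \<in> {..<I p}"
      then have "prob (?R p i e \<union> ?R p i f) \<le> prob (?R p i e) + prob (?R p i f)"
        using R_event by (intro measure_Un_le) auto
      also have "\<dots> \<le> 2 * exp (- L p) + 2 * exp (- L p)"
        using p i e f by (intro add_mono R_prob) auto
      finally show "prob (?R p i e \<union> ?R p i f) \<le> 2 * exp (- L p) + 2 * exp (- L p)" .
    qed
    also have "\<dots> = (\<Sum>p=1..P. \<eta>)"
    proof (intro sum.cong refl)
      fix p assume "p \<in> {1..P}"
      then show "(\<Sum>i<I p. 2 * exp (- L p) + 2 * exp (- L p)) = \<eta>"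
        using I_pos[of p] \<eta> by (simp add: L_def exp_minus field_simps)
    qed
    finally have U_prob: "prob ?U \<le> P * \<eta>"
      by simp
    let ?F = "{\<omega>\<in>space M. \<not> ?ok \<omega>}"
    \<comment> \<open>Off the event \<open>?U\<close> every factor is incoherent.\<close>
    have outside: "good (?\<tau> \<omega>)" if "\<omega> \<in> space M - ?U" for \<omega>
      unfolding good_def
    proof (intro ballI allI impI)
      fix p i assume p: "p \<in> {1..P}" and i: "i < I p"
      then have "\<omega> \<notin> ?R p i e" "\<omega> \<notin> ?R p i f"
        using that by blast+
      then show "\<bar>\<Sum>j<I p. factor (?\<tau> \<omega>) p $$ (i, j) * e p j\<bar> < t p
          \<and> \<bar>\<Sum>j<I p. factor (?\<tau> \<omega>) p $$ (i, j) * f p j\<bar> < t p"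
        using that unfolding factor_\<tau>[OF p] by (simp add: not_le)
    qed
    have Q_prob: "prob (?F - ?U) \<le> \<eta>"
    proof -
      have ln_pos: "0 < ln (4 / \<eta>)"
        using \<eta> by simp
      have "16 / 3 * m * ln (4 / \<eta>) / \<epsilon>\<^sup>2 < J"
        using J_large by (simp add: m_def L_def mult_ac)
      then have "16 / 3 * m * ln (4 / \<eta>) < J * \<epsilon>\<^sup>2"
        using \<epsilon> by (simp add: field_simps)
      \<comment> \<open>Chernoff loses a factor 4, so the constant 16/3 still leaves 4/3 \<open>\<ge>\<close> 1 in the exponent.\<close>
      then have "4 / 3 * ln (4 / \<eta>) < J * \<epsilon>\<^sup>2 / (4 * m)"
        using m by (simp add: field_simps)
      then have "ln (4 / \<eta>) \<le> J * \<epsilon>\<^sup>2 / (4 * m)"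
        using ln_pos by linarith
      then have "2 * exp (- (J * \<epsilon>\<^sup>2 / (4 * m))) \<le> 2 * exp (- ln (4 / \<eta>))"
        by simp
      also have "\<dots> = \<eta> / 2"
        using \<eta> by (simp add: exp_minus)
      finally have "2 * exp (- (J * \<epsilon>\<^sup>2 / (4 * m))) \<le> \<eta>"
        using \<eta> by simp
      moreover have "prob (?F - ?U) \<le> 2 * exp (- (J * \<epsilon>\<^sup>2 / (4 * m)))"
      proof (rule sampling_tail[OF finite_sign_positions _ _ _ total_dim_pos \<epsilon> m])
        show "indep_vars (\<lambda>_. borel) (case_sum (\<lambda>(p, i). d p i) (\<lambda>j \<omega>. real (v j \<omega>))) (sign_positions <+> {..<J})"
          using indep by (simp add: sign_positions_def)
        show "rademacher M ((\<lambda>(p, i). d p i) k)" if "k \<in> sign_positions" for k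
          using that signs by (auto simp: sign_positions_def)
        show "uniform_index M total_dim (v j)" if "j < J" for j
          using indices[OF that] by (simp add: total_dim_def)
        show "?F - ?U \<subseteq> {\<omega>\<in>space M. good (?\<tau> \<omega>) \<and> \<epsilon> * J < \<bar>(\<Sum>j<J. g (?\<tau> \<omega>) (v j \<omega>)) - J\<bar>}"
          using outside by (auto simp: ok G_def not_le)
      qed (use g_bound g_mean in auto)
      ultimately show ?thesis
        by linarith
    qed
    have F_event: "?F \<in> events"
      using sketch_measurable[OF x y] by measurable
    have "prob ?F \<le> prob ((?F - ?U) \<union> ?U)"
      using F_event U_event by (intro finite_measure_mono) auto
    also have "\<dots> \<le> prob (?F - ?U) + prob ?U"
      using F_event U_event by (intro measure_Un_le) auto
    also have "\<dots> \<le> \<eta> + P * \<eta>"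
      using Q_prob U_prob by (rule add_mono)
    finally show ?thesis
      by (simp add: algebra_simps)
  qed
qed

end

section \<open>The Johnson--Lindenstrauss guarantee\<close>

theorem theorem4p2:
  fixes M :: "'a measure"
    and P N J :: nat
    and I :: "nat \<Rightarrow> nat"
    and \<epsilon> \<delta> :: real
    and X :: "real Matrix.vec set"
    and d :: "nat \<Rightarrow> nat \<Rightarrow> 'a \<Rightarrow> real"
    and v :: "nat \<Rightarrow> 'a \<Rightarrow> nat"
  defines "It \<equiv> \<Prod>p=1..P. I p"
  defines "K \<equiv> (SIGMA p:{1..P}. {..<I p})"
  defines "\<Phi> \<equiv> (\<lambda>\<omega>. kron_mats (\<lambda>p. hadamard_transform (I p) (\<lambda>i. d p i \<omega>)) P)"
  defines "S \<equiv> (\<lambda>\<omega>. sampling_mat J It (\<lambda>j. v j \<omega>))"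
  assumes "P \<ge> 1" and "N \<ge> 1" and "J \<ge> 1"
    and "\<forall>p\<in>{1..P}. \<exists>k. I p = 2 ^ k"
    and "0 < \<epsilon>" and "\<epsilon> < 1" and "0 < \<delta>" and "\<delta> < 1"
    and "X \<subseteq> kronecker_vectors I P" and "card X = N"
    and "prob_space M"
    and "\<forall>p\<in>{1..P}. \<forall>i<I p. rademacher M (d p i)"
    and "\<forall>j<J. uniform_index M It (v j)"
    and "prob_space.indep_vars M (\<lambda>_. borel)
           (case_sum (\<lambda>(p, i). d p i) (\<lambda>j \<omega>. real (v j \<omega>))) (K <+> {..<J})"
    and "real J > 16 / 3 * 4 ^ P * (1 / \<epsilon>\<^sup>2) * ln (4 * (real N)\<^sup>2 * (real P + 1) / \<delta>)
           * (\<Prod>p=1..P. ln (4 * real (I p) * (real N)\<^sup>2 * (real P + 1) / \<delta>))"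
  shows "\<P>(\<omega> in M. \<forall>x\<in>X. \<forall>y\<in>X.
           (1 - \<epsilon>) * (l2_norm (x - y))\<^sup>2
             \<le> (l2_norm (S \<omega> *\<^sub>v (\<Phi> \<omega> *\<^sub>v x) - S \<omega> *\<^sub>v (\<Phi> \<omega> *\<^sub>v y)))\<^sup>2
         \<and> (l2_norm (S \<omega> *\<^sub>v (\<Phi> \<omega> *\<^sub>v x) - S \<omega> *\<^sub>v (\<Phi> \<omega> *\<^sub>v y)))\<^sup>2
             \<le> (1 + \<epsilon>) * (l2_norm (x - y))\<^sup>2) \<ge> 1 - \<delta>"
proof -
  have N: "1 \<le> N" and \<epsilon>: "0 < \<epsilon>" "\<epsilon> < 1" and \<delta>: "0 < \<delta>" "\<delta> < 1"
    and X: "X \<subseteq> kronecker_vectors I P" and card: "card X = N"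
    by fact+
  interpret prob_space M
    by fact
  interpret kronecker_fjlt M P J I d v
    using assms(7-) by unfold_locales (auto simp: It_def K_def)
  have fin: "finite X"
    using card N by (intro card_ge_0_finite) simp
  have sk: "S \<omega> *\<^sub>v (\<Phi> \<omega> *\<^sub>v x) = sketch \<omega> x" for \<omega> x
  proof -
    have "factor (\<lambda>(p, i). d p i \<omega>) = (\<lambda>p. hadamard_transform (I p) (\<lambda>i. d p i \<omega>))"
      by (rule ext) (simp add: factor_def)
    then show ?thesis
      by (simp add: S_def \<Phi>_def sketch_def transform_def It_def total_dim_def)
  qed
  \<comment> \<open>There are \<open>N\<^sup>2\<close> ordered pairs and \<open>P + 1\<close> sources of failure for each.\<close>
  define \<eta> where "\<eta> = \<delta> / ((real N)\<^sup>2 * (real P + 1))"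
  have NP: "1 \<le> (real N)\<^sup>2 * (real P + 1)"
    using N mult_mono[of 1 "(real N)\<^sup>2" 1 "real P + 1"] by simp
  have \<eta>: "0 < \<eta>" "\<eta> < 1"
    using \<delta> NP by (auto simp: \<eta>_def field_simps)
  have J_large: "real J > 16 / 3 * 4 ^ P * (1 / \<epsilon>\<^sup>2) * ln (4 / \<eta>) * (\<Prod>p=1..P. ln (4 * real (I p) / \<eta>))"
    using assms(19) by (simp add: \<eta>_def mult.assoc)
  let ?ok = "\<lambda>x y \<omega>. (1 - \<epsilon>) * (l2_norm (x - y))\<^sup>2 \<le> (l2_norm (sketch \<omega> x - sketch \<omega> y))\<^sup>2
    \<and> (l2_norm (sketch \<omega> x - sketch \<omega> y))\<^sup>2 \<le> (1 + \<epsilon>) * (l2_norm (x - y))\<^sup>2"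
  let ?F = "\<lambda>x y. {\<omega>\<in>space M. \<not> ?ok x y \<omega>}"
  let ?U = "\<Union>x\<in>X. \<Union>y\<in>X. ?F x y"
  have F: "?F x y \<in> events" if "x \<in> X" "y \<in> X" for x y
    using sketch_measurable[OF subsetD[OF X that(1)] subsetD[OF X that(2)]] by measurable
  have "prob ?U \<le> (\<Sum>x\<in>X. prob (\<Union>y\<in>X. ?F x y))"
    by (intro finite_measure_subadditive_finite fin image_subsetI sets.finite_UN F)
  also have "\<dots> \<le> (\<Sum>x\<in>X. \<Sum>y\<in>X. prob (?F x y))"
    by (intro sum_mono finite_measure_subadditive_finite fin image_subsetI F)
  also have "\<dots> \<le> (\<Sum>x\<in>X. \<Sum>y\<in>X. (P + 1) * \<eta>)"
    by (intro sum_mono pair_failure \<epsilon> \<eta> J_large) (use X in auto)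
  also have "\<dots> = \<delta>"
    using N by (simp add: card \<eta>_def power2_eq_square add_ac)
  finally have "1 - \<delta> \<le> prob (space M - ?U)"
    by (subst prob_compl) (intro sets.finite_UN fin F, simp_all)
  also have "space M - ?U = {\<omega>\<in>space M. \<forall>x\<in>X. \<forall>y\<in>X. ?ok x y \<omega>}"
    by blast
  finally show ?thesis
    unfolding sk .
qed

end
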